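(* Let $1\le p<\infty$ and let $f\in L^1_{k,\mathrm{loc}}(\mathbb{R}^n)$. Then $f\in BMO(\mathcal{L}_k)$ if and only if for every ball $B$ in $\mathbb{R}^n$ there exists a constant $\mathfrak{C}_B$ such that the following two conditions hold: (i) $$C_p=\sup_{B}\left(\frac{1}{\omega_k(B)}\int_B |f(x)-\mathfrak{C}_B|^p\,w_k(x)\,dx\right)^{1/p}<\infty ,$$ where the supremum is over all balls $B\subset\mathbb{R}^n$; (ii) $$C=\sup_{\substack{B=B(x,r)\\ x\in\mathbb{R}^n,\ r>0}}\ \frac{|\mathfrak{C}_B|}{\log_2\!\left(1+\frac{\rho_k(x)}{r}\right)}<\infty .$$ Moreover, $$\|f\|_{BMO(\mathcal{L}_k)}\approx \inf_{\{\mathfrak{C}_B\}}\ \max\{C_p,C\},$$ where the infimum is taken over all families $\{\mathfrak{C}_B\}$ satisfying (i) and (ii), and $\approx$ means that each side is bounded by a positive constant, independent of $f$, times the other.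
   Context: Setting. Let $\mathcal{R}\subset\mathbb{R}^n\setminus\{0\}$ be a normalized root system: a finite set with $|\zeta|^2=2$, $\sigma_\zeta(\mathcal{R})=\mathcal{R}$ and $\mathcal{R}\cap\mathbb{R}\zeta=\{\pm\zeta\}$ for all $\zeta\in\mathcal{R}$, where $\sigma_\zeta(x)=x-2\frac{\langle x,\zeta\rangle}{|\zeta|^2}\zeta$. Let $G$ be the finite group generated by the $\sigma_\zeta$, and $\mathcal{R}_+=\{\zeta\in\mathcal{R}:\langle\zeta,b\rangle>0\}$ for a fixed $b$ orthogonal to no root. Let $k:\mathcal{R}\to[0,\infty)$ be $G$-invariant, $\gamma=\sum_{\zeta\in\mathcal{R}_+}k(\zeta)$, $w_k(x)=\prod_{\zeta\in\mathcal{R}_+}|\langle\zeta,x\rangle|^{2k(\zeta)}$, and $\omega_k(A)=\int_A w_k(x)\,dx$. $B(x,r)$ is the Euclidean ball with center $x$ and radius $r$. $L^1_{k,\mathrm{loc}}(\mathbb{R}^n)$ is the space of functions locally integrable with respect to $w_k(x)\,dx$. Potential. $V\ge 0$, $V\not\equiv 0$, belongs to the reverse Hölder class $RH_k^q(\mathbb{R}^n)$ with $q>\max\{1,\frac{n+2\gamma}{2}\}$: $V\in L^1_{k,\mathrm{loc}}(\mathbb{R}^n)$ and there is $C_{RH}>0$ with $\left(\frac{1}{\omega_k(B)}\int_B V^q w_k\,dx\right)^{1/q}\le \frac{C_{RH}}{\omega_k(B)}\int_B V w_k\,dx$ for every ball $B$. The critical radius function is $\rho_k(x)=\sup\{r>0:\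 \frac{r^2}{\omega_k(B(x,r))}\int_{B(x,r)}V(\xi)w_k(\xi)\,d\xi\le 1\}$; one has $0<\rho_k(x)<\infty$. The space $BMO(\mathcal{L}_k)$. Put $f_B=\frac{1}{\omega_k(B)}\int_B f(x)w_k(x)\,dx$. A function $f\in L^1_{k,\mathrm{loc}}(\mathbb{R}^n)$ is in $BMO(\mathcal{L}_k)$ if there is $C_f\ge 0$ such that $\frac{1}{\omega_k(B(x,s))}\int_{B(x,s)}|f(y)-f_{B(x,s)}|w_k(y)\,dy\le C_f$ and $\frac{1}{\omega_k(B(x,r))}\int_{B(x,r)}|f(y)|w_k(y)\,dy\le C_f$ for all $x\in\mathbb{R}^n$ and all $s<\rho_k(x)\le r$. The smallest such $C_f$ is denoted $\|f\|_{BMO(\mathcal{L}_k)}$. *)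

theory Defs
  imports "HOL-Analysis.Analysis"
begin

section \<open>Root systems and the Dunkl measure\<close>

definition root_reflection :: "'a::real_inner \<Rightarrow> 'a \<Rightarrow> 'a" where
  "root_reflection \<zeta> x = x - (2 * (x \<bullet> \<zeta>) / (norm \<zeta>)\<^sup>2) *\<^sub>R \<zeta>"

definition normalized_root_system :: "'a::real_inner set \<Rightarrow> bool" where
  "normalized_root_system R \<longleftrightarrow>
     finite R \<and> 0 \<notin> R \<and>
     (\<forall>\<zeta>\<in>R. (norm \<zeta>)\<^sup>2 = 2 \<and> root_reflection \<zeta> ` R = R \<and>
             R \<inter> range (\<lambda>t. t *\<^sub>R \<zeta>) = {\<zeta>, - \<zeta>})"

inductive_set reflection_group :: "'a::real_inner set \<Rightarrow> ('a \<Rightarrow> 'a) set"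
  for R :: "'a set" where
  one: "id \<in> reflection_group R"
| gen: "\<zeta> \<in> R \<Longrightarrow> root_reflection \<zeta> \<in> reflection_group R"
| inv: "g \<in> reflection_group R \<Longrightarrow> inv g \<in> reflection_group R"
| mult: "g \<in> reflection_group R \<Longrightarrow> h \<in> reflection_group R \<Longrightarrow> g \<circ> h \<in> reflection_group R"

definition pos_roots :: "'a::real_inner set \<Rightarrow> 'a \<Rightarrow> 'a set" where
  "pos_roots R b = {\<zeta> \<in> R. \<zeta> \<bullet> b > 0}"

text \<open>Multiplicity functions are total here; only their values on the roots matter.\<close>

definition multiplicity_function :: "'a::real_inner set \<Rightarrow> ('a \<Rightarrow> real) \<Rightarrow> bool" where
  "multiplicity_function R k \<longleftrightarrow>
     (\<forall>\<zeta>\<in>R. k \<zeta> \<ge> 0) \<and> (\<forall>g\<in>reflection_group R. \<forall>\<zeta>\<in>R. k (g \<zeta>) = k \<zeta>)"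

definition dunkl_gamma :: "'a::real_inner set \<Rightarrow> 'a \<Rightarrow> ('a \<Rightarrow> real) \<Rightarrow> real" where
  "dunkl_gamma R b k = (\<Sum>\<zeta>\<in>pos_roots R b. k \<zeta>)"

text \<open>The case distinction implements the convention that the zeroth power of 0 is 1,
  whereas \<open>0 powr 0 = 0\<close>.\<close>

definition dunkl_weight :: "'a::real_inner set \<Rightarrow> 'a \<Rightarrow> ('a \<Rightarrow> real) \<Rightarrow> 'a \<Rightarrow> real" where
  "dunkl_weight R b k x =
     (\<Prod>\<zeta>\<in>pos_roots R b. if k \<zeta> = 0 then 1 else \<bar>\<zeta> \<bullet> x\<bar> powr (2 * k \<zeta>))"

text \<open>The density is taken over \<open>lebesgue\<close> rather than \<open>lborel\<close>, so that measurability
  means Lebesgue measurability.\<close>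

definition dunkl_measure :: "'a::euclidean_space set \<Rightarrow> 'a \<Rightarrow> ('a \<Rightarrow> real) \<Rightarrow> 'a measure" where
  "dunkl_measure R b k = density lebesgue (\<lambda>x. ennreal (dunkl_weight R b k x))"


section \<open>Local integrability and means\<close>

definition locally_integrable ::
    "'a::euclidean_space measure \<Rightarrow> ('a \<Rightarrow> 'b::{banach,second_countable_topology}) \<Rightarrow> bool" where
  "locally_integrable \<omega> f \<longleftrightarrow> (\<forall>K. compact K \<longrightarrow> set_integrable \<omega> K f)"

definition mean ::
    "'a measure \<Rightarrow> 'a set \<Rightarrow> ('a \<Rightarrow> 'b::{banach,second_countable_topology}) \<Rightarrow> 'b" where
  "mean \<omega> B f = (1 / measure \<omega> B) *\<^sub>R (LINT x:B|\<omega>. f x)"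

definition ennreal_powr :: "ennreal \<Rightarrow> real \<Rightarrow> ennreal" where
  "ennreal_powr t a = (if t = \<infinity> then \<infinity> else ennreal (enn2real t powr a))"

text \<open>The normalized \<open>L\<^sup>p\<close>-mean takes values in \<open>[0,\<infinity>]\<close>: it is \<open>\<infinity>\<close>, not a default value,
  when the \<open>p\<close>-th power of the norm is not integrable over the set.\<close>

definition Lp_mean ::
    "'a measure \<Rightarrow> real \<Rightarrow> 'a set \<Rightarrow> ('a \<Rightarrow> 'b::real_normed_vector) \<Rightarrow> ennreal" where
  "Lp_mean \<omega> p B f =
     ennreal_powr ((\<integral>\<^sup>+x\<in>B. ennreal (norm (f x) powr p) \<partial>\<omega>) / emeasure \<omega> B) (1 / p)"


section \<open>The potential and its critical radius\<close>

definition reverse_Hoelder :: "'a::euclidean_space measure \<Rightarrow> real \<Rightarrow> ('a \<Rightarrow> real) \<Rightarrow> bool" where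
  "reverse_Hoelder \<omega> q V \<longleftrightarrow>
     locally_integrable \<omega> V \<and>
     (\<exists>C>0. \<forall>x. \<forall>r>0. Lp_mean \<omega> q (ball x r) V \<le> ennreal (C * mean \<omega> (ball x r) V))"

definition critical_radius :: "'a::euclidean_space measure \<Rightarrow> ('a \<Rightarrow> real) \<Rightarrow> 'a \<Rightarrow> real" where
  "critical_radius \<omega> V x = Sup {r. r > 0 \<and> r\<^sup>2 * mean \<omega> (ball x r) V \<le> 1}"


section \<open>BMO associated with a critical radius function\<close>

definition BMO_bound ::
    "'a::euclidean_space measure \<Rightarrow> ('a \<Rightarrow> real) \<Rightarrow>
     ('a \<Rightarrow> 'b::{banach,second_countable_topology}) \<Rightarrow> real \<Rightarrow> bool" where
  "BMO_bound \<omega> \<rho> f C \<longleftrightarrow>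
     C \<ge> 0 \<and>
     (\<forall>x s. 0 < s \<and> s < \<rho> x \<longrightarrow>
        mean \<omega> (ball x s) (\<lambda>y. norm (f y - mean \<omega> (ball x s) f)) \<le> C) \<and>
     (\<forall>x r. 0 < r \<and> \<rho> x \<le> r \<longrightarrow> mean \<omega> (ball x r) (\<lambda>y. norm (f y)) \<le> C)"

definition BMO_space ::
    "'a::euclidean_space measure \<Rightarrow> ('a \<Rightarrow> real) \<Rightarrow>
     ('a \<Rightarrow> 'b::{banach,second_countable_topology}) set" where
  "BMO_space \<omega> \<rho> = {f. locally_integrable \<omega> f \<and> (\<exists>C. BMO_bound \<omega> \<rho> f C)}"

definition BMO_norm ::
    "'a::euclidean_space measure \<Rightarrow> ('a \<Rightarrow> real) \<Rightarrow>
     ('a \<Rightarrow> 'b::{banach,second_countable_topology}) \<Rightarrow> real" where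
  "BMO_norm \<omega> \<rho> f = Inf {C. BMO_bound \<omega> \<rho> f C}"

text \<open>A family of constants indexed by the balls is a function \<open>c\<close> of centre and radius;
  only its values at positive radii are used.\<close>

definition osc_const ::
    "'a::euclidean_space measure \<Rightarrow> real \<Rightarrow> ('a \<Rightarrow> 'b::real_normed_vector) \<Rightarrow>
     ('a \<Rightarrow> real \<Rightarrow> 'b) \<Rightarrow> ennreal" where
  "osc_const \<omega> p f c = (SUP x. SUP r\<in>{0<..}. Lp_mean \<omega> p (ball x r) (\<lambda>y. f y - c x r))"

definition log_const :: "('a \<Rightarrow> real) \<Rightarrow> ('a \<Rightarrow> real \<Rightarrow> 'b::real_normed_vector) \<Rightarrow> ennreal" where
  "log_const \<rho> c = (SUP x. SUP r\<in>{0<..}. ennreal (norm (c x r) / log 2 (1 + \<rho> x / r)))"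

definition admissible_families ::
    "'a::euclidean_space measure \<Rightarrow> ('a \<Rightarrow> real) \<Rightarrow> real \<Rightarrow> ('a \<Rightarrow> 'b::real_normed_vector) \<Rightarrow>
     ('a \<Rightarrow> real \<Rightarrow> 'b) set" where
  "admissible_families \<omega> \<rho> p f = {c. osc_const \<omega> p f c < \<infinity> \<and> log_const \<rho> c < \<infinity>}"

end

theory Submission
  imports Defs "HOL-Real_Asymp.Real_Asymp"
begin

text \<open>
  The characterization rests on two properties of the data. The Dunkl measure is doubling
  (\<open>dunkl_measure_doubling\<close>), and the critical radius is positive (\<open>critical_radius_pos\<close>). For any
  doubling measure and any positive radius function \<open>\<rho>\<close> the equivalence then follows
  (\<open>BMO_characterization\<close>).

  From a family \<open>c\<close> to the norm the argument is elementary. On a ball with \<open>r < \<rho> x\<close> the mean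
  oscillation about \<open>f\<^sub>B\<close> is at most twice that about \<open>c\<close>; on a ball with \<open>r \<ge> \<rho> x\<close> the
  logarithm lies in \<open>(0, 1]\<close>, so \<open>c\<close> itself is bounded, and the mean of \<open>|f|\<close> is controlled by the mean
  of \<open>|f - c|\<close> and \<open>|c|\<close>.

  From the norm to a family, take \<open>c = f\<^sub>B\<close> when \<open>r < \<rho> x\<close> and \<open>c = 0\<close> otherwise. The logarithmic
  bound comes from doubling the ball about \<open>log\<^sub>2 (\<rho> x / r)\<close> times until its radius passes
  \<open>\<rho> x\<close>: each step changes the mean by a bounded amount (\<open>mean_le_log\<close>). The \<open>L\<^sup>p\<close> bound is the
  John-Nirenberg inequality (\<open>john_nirenberg_ball\<close>). It is proved for
  nested partitions: a cell is stopped when its mean has moved by more than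
  \<open>2A\<close>, where \<open>A\<close> bounds the mean oscillations. The stopped cells fill at most half of the starting
  cell, so iteration gives exponential decay (\<open>john_nirenberg_tail\<close>). Off the stopped cells \<open>f\<close> must stay
  close to the starting mean. Instead of Lebesgue's differentiation theorem this uses that a set
  occupying at most half of every cell is null (\<open>null_if_half_density\<close>).

  The Dunkl measure is doubling because every ball \<open>B(x,r)\<close> contains a ball of comparable radius
  on which \<open>|\<langle>\<zeta>, z\<rangle>|\<close> is at least a fixed multiple of \<open>r\<close> for all roots at once
  (\<open>exists_point_off_hyperplanes\<close>); there the weight dominates its values on larger balls up to a power of
  the ratio of radii. The growth exponent is \<open>n + 2\<gamma>\<close>. The reverse Hoelder inequality turns this
  growth into \<open>r\<^sup>2 V\<^sub>r \<le> K (r/s)\<^bsup>\<epsilon>\<^esup> s\<^sup>2 V\<^sub>s\<close> for \<open>r \<le> s\<close>, where \<open>V\<^sub>r\<close> is the mean of \<open>V\<close> over \<open>B(x,r)\<close>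
  and \<open>\<epsilon> = 2 - (n + 2\<gamma>)/q > 0\<close>. So \<open>r\<^sup>2 V\<^sub>r\<close> tends to \<open>0\<close> at \<open>0\<close> and to infinity at infinity.
\<close>

section \<open>Means on sets of finite positive measure\<close>

text \<open>Upper integrals and Bochner means meet here: the tail and \<open>L\<^sup>p\<close> estimates below are computed
  with the former, while oscillations are given by the latter.\<close>

lemma set_nn_integral_norm_eq_mean:
  fixes f :: "'a \<Rightarrow> 'b::{banach,second_countable_topology}"
  assumes f: "set_integrable \<omega> B f" and fin: "emeasure \<omega> B < \<infinity>" and pos: "0 < emeasure \<omega> B"
  shows "(\<integral>\<^sup>+y\<in>B. ennreal (norm (f y)) \<partial>\<omega>)
         = ennreal (measure \<omega> B * mean \<omega> B (\<lambda>y. norm (f y)))"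
proof -
  have m: "measure \<omega> B > 0"
    using fin pos by (simp add: measure_def enn2real_positive_iff)
  have "(\<integral>\<^sup>+y\<in>B. ennreal (norm (f y)) \<partial>\<omega>) = (\<integral>\<^sup>+y. ennreal (norm (indicat_real B y *\<^sub>R f y)) \<partial>\<omega>)"
    by (intro nn_integral_cong) (auto simp: indicator_def)
  also have "\<dots> = ennreal (\<integral>y. norm (indicat_real B y *\<^sub>R f y) \<partial>\<omega>)"
    by (intro nn_integral_eq_integral integrable_norm f[unfolded set_integrable_def]) auto
  also have "(\<integral>y. norm (indicat_real B y *\<^sub>R f y) \<partial>\<omega>) = (LINT y:B|\<omega>. norm (f y))"
    unfolding set_lebesgue_integral_def by (intro Bochner_Integration.integral_cong) auto
  also have "\<dots> = measure \<omega> B * mean \<omega> B (\<lambda>y. norm (f y))"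
    using m by (simp add: mean_def)
  finally show ?thesis .
qed

lemma mean_norm_nonneg: "0 \<le> mean \<omega> B (\<lambda>y. norm (f y))"
  unfolding mean_def set_lebesgue_integral_def
  by (intro scaleR_nonneg_nonneg Bochner_Integration.integral_nonneg) auto

lemma set_integrable_diff_const:
  fixes f :: "'a \<Rightarrow> 'b::{banach,second_countable_topology}"
  assumes f: "set_integrable \<omega> B f" and B: "B \<in> sets \<omega>" and fin: "emeasure \<omega> B < \<infinity>"
  shows "set_integrable \<omega> B (\<lambda>y. f y - a)"
proof -
  have "set_integrable \<omega> B (\<lambda>y. a)"
    unfolding set_integrable_def
    by (rule integrable_scaleR_left) (use B fin in simp)
  then show ?thesis
    using f by (intro set_integral_diff) auto
qed

lemma mean_const:
  assumes B: "B \<in> sets \<omega>" and fin: "emeasure \<omega> B < \<infinity>" and pos: "0 < emeasure \<omega> B"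
  shows "mean \<omega> B (\<lambda>y. a :: 'b::{banach,second_countable_topology}) = a"
proof -
  have m: "measure \<omega> B > 0"
    using fin pos by (simp add: measure_def enn2real_positive_iff)
  show ?thesis
    unfolding mean_def set_lebesgue_integral_def using m B fin by simp
qed

lemma mean_diff_const:
  fixes f :: "'a \<Rightarrow> 'b::{banach,second_countable_topology}"
  assumes f: "set_integrable \<omega> B f" and B: "B \<in> sets \<omega>" and fin: "emeasure \<omega> B < \<infinity>"
    and pos: "0 < emeasure \<omega> B"
  shows "mean \<omega> B (\<lambda>y. f y - a) = mean \<omega> B f - a"
proof -
  have "set_integrable \<omega> B (\<lambda>y. a)"
    unfolding set_integrable_def
    by (rule integrable_scaleR_left) (use B fin in simp)
  then have "mean \<omega> B (\<lambda>y. f y - a) = mean \<omega> B f - mean \<omega> B (\<lambda>y. a)"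
    unfolding mean_def using f by (simp add: scaleR_diff_right)
  then show ?thesis
    using mean_const[OF B fin pos] by metis
qed

lemma norm_mean_le:
  fixes f :: "'a \<Rightarrow> 'b::{banach,second_countable_topology}"
  assumes f: "set_integrable \<omega> B f"
  shows "norm (mean \<omega> B f) \<le> mean \<omega> B (\<lambda>y. norm (f y))"
proof -
  have "norm (LINT x:B|\<omega>. f x) \<le> (LINT x:B|\<omega>. norm (f x))"
    using set_integral_norm_bound[OF f] .
  then show ?thesis
    unfolding mean_def by (simp add: divide_right_mono)
qed

lemma norm_mean_diff_le:
  fixes f :: "'a \<Rightarrow> 'b::{banach,second_countable_topology}"
  assumes f: "set_integrable \<omega> B f" and B: "B \<in> sets \<omega>" and fin: "emeasure \<omega> B < \<infinity>"
    and pos: "0 < emeasure \<omega> B"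
  shows "norm (mean \<omega> B f - a) \<le> mean \<omega> B (\<lambda>y. norm (f y - a))"
  using norm_mean_le[OF set_integrable_diff_const[OF f B fin, of a]]
    mean_diff_const[OF f B fin pos, of a] by simp

text \<open>Passing to a subset of comparable measure costs the ratio of the measures.\<close>

lemma mean_norm_mono_set:
  fixes f :: "'a \<Rightarrow> 'b::{banach,second_countable_topology}"
  assumes f: "set_integrable \<omega> B f" and AB: "A \<subseteq> B" and A: "A \<in> sets \<omega>"
    and pos: "0 < measure \<omega> A" and le: "measure \<omega> B \<le> D * measure \<omega> A"
    and posB: "0 < measure \<omega> B"
  shows "mean \<omega> A (\<lambda>y. norm (f y)) \<le> D * mean \<omega> B (\<lambda>y. norm (f y))"
proof -
  let ?I = "\<lambda>S. LINT y:S|\<omega>. norm (f y)"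
  have fn: "set_integrable \<omega> B (\<lambda>y. norm (f y))"
    using f set_integrable_norm by blast
  have fA: "set_integrable \<omega> A (\<lambda>y. norm (f y))"
    using set_integrable_subset[OF fn A AB] .
  have I: "?I A \<le> ?I B"
    unfolding set_lebesgue_integral_def
    using fA fn AB unfolding set_integrable_def
    by (intro integral_mono) (auto simp: indicator_def)
  have "0 \<le> ?I B"
    unfolding set_lebesgue_integral_def by (intro Bochner_Integration.integral_nonneg) auto
  then have "?I B * measure \<omega> B \<le> ?I B * (D * measure \<omega> A)"
    using le by (intro mult_left_mono) auto
  then have "?I B / measure \<omega> A \<le> D * (?I B / measure \<omega> B)"
    using pos posB by (simp add: field_simps)
  moreover have "?I A / measure \<omega> A \<le> ?I B / measure \<omega> A"
    using I pos by (intro divide_right_mono) auto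
  ultimately show ?thesis
    unfolding mean_def by simp
qed

lemma mean_triangle:
  fixes f :: "'a \<Rightarrow> 'b::{banach,second_countable_topology}"
  assumes f: "set_integrable \<omega> B f" and B: "B \<in> sets \<omega>" and fin: "emeasure \<omega> B < \<infinity>"
    and pos: "0 < emeasure \<omega> B"
  shows "mean \<omega> B (\<lambda>y. norm (f y - b)) \<le> mean \<omega> B (\<lambda>y. norm (f y - a)) + norm (a - b)"
proof -
  have i: "set_integrable \<omega> B (\<lambda>y. norm (f y - c))" for c
    using set_integrable_norm[OF set_integrable_diff_const[OF f B fin]] by blast
  have k: "set_integrable \<omega> B (\<lambda>y. norm (a - b))"
    unfolding set_integrable_def
    by (rule integrable_scaleR_left) (use B fin in simp)
  have "(LINT y:B|\<omega>. norm (f y - b)) \<le> (LINT y:B|\<omega>. norm (f y - a) + norm (a - b))"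
    by (intro set_integral_mono i set_integral_add k)
       (metis diff_add_cancel add_diff_eq norm_triangle_ineq)
  then have "mean \<omega> B (\<lambda>y. norm (f y - b)) \<le> mean \<omega> B (\<lambda>y. norm (f y - a) + norm (a - b))"
    unfolding mean_def by (simp add: divide_right_mono)
  also have "\<dots> = mean \<omega> B (\<lambda>y. norm (f y - a)) + mean \<omega> B (\<lambda>y. norm (a - b))"
    unfolding mean_def using i[of a] k by (simp add: add_divide_distrib)
  finally show ?thesis
    using mean_const[OF B fin pos, of "norm (a-b)"] by simp
qed

text \<open>The mean is a best centre up to the factor \<open>2\<close>, because it lies within one oscillation of any
  other centre.\<close>

lemma mean_oscillation_le:
  fixes f :: "'a \<Rightarrow> 'b::{banach,second_countable_topology}"
  assumes f: "set_integrable \<omega> B f" and B: "B \<in> sets \<omega>" and fin: "emeasure \<omega> B < \<infinity>"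
    and pos: "0 < emeasure \<omega> B"
  shows "mean \<omega> B (\<lambda>y. norm (f y - mean \<omega> B f)) \<le> 2 * mean \<omega> B (\<lambda>y. norm (f y - a))"
  using mean_triangle[OF assms, of "mean \<omega> B f" a] norm_mean_diff_le[OF assms, of a]
  by (simp add: norm_minus_commute)

lemma Lp_mean_le_iff:
  assumes fin: "emeasure \<omega> B < \<infinity>" and pos: "0 < emeasure \<omega> B" and p: "1 \<le> p" and L: "0 \<le> L"
  shows "Lp_mean \<omega> p B g \<le> ennreal L \<longleftrightarrow>
    (\<integral>\<^sup>+x\<in>B. ennreal (norm (g x) powr p) \<partial>\<omega>) \<le> ennreal (L powr p) * emeasure \<omega> B"
proof -
  define I where "I = (\<integral>\<^sup>+x\<in>B. ennreal (norm (g x) powr p) \<partial>\<omega>)"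
  define t where "t = I / emeasure \<omega> B"
  have a: "I \<le> ennreal (L powr p) * emeasure \<omega> B \<longleftrightarrow> t \<le> ennreal (L powr p)"
    unfolding t_def using fin pos
    by (metis divide_le_posI_ennreal ennreal_divide_times ennreal_mult_divide_eq
        ennreal_times_divide infinity_ennreal_def less_irrefl mult.commute mult_left_mono zero_le)
  have b: "ennreal_powr t (1/p) \<le> ennreal L \<longleftrightarrow> t \<le> ennreal (L powr p)"
  proof (cases t)
    case (real u)
    have "u powr (1/p) \<le> L \<longleftrightarrow> u \<le> L powr p"
    proof
      assume "u powr (1/p) \<le> L"
      then have "(u powr (1/p)) powr p \<le> L powr p"
        using p by (intro powr_mono2) auto
      then show "u \<le> L powr p" using real p by (simp add: powr_powr)
    next
      assume "u \<le> L powr p"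
      then have "u powr (1/p) \<le> (L powr p) powr (1/p)"
        using p real by (intro powr_mono2) auto
      then show "u powr (1/p) \<le> L" using L p by (simp add: powr_powr)
    qed
    then show ?thesis
      using real L by (simp add: ennreal_powr_def)
  next
    case top
    then show ?thesis by (simp add: ennreal_powr_def top_unique)
  qed
  show ?thesis
    unfolding Lp_mean_def using a b unfolding t_def I_def by simp
qed

text \<open>A substitute for Jensen's inequality with the constant \<open>2\<close>. It comes from the pointwise bound
  \<open>u \<le> L + L\<^bsup>1-p\<^esup> u\<^bsup>p\<^esup>\<close>, which is clear for \<open>u \<le> L\<close> and for \<open>u \<ge> L\<close> follows from \<open>u\<^bsup>1-p\<^esup> \<le> L\<^bsup>1-p\<^esup>\<close>.\<close>

lemma set_nn_integral_le_of_powr: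
  fixes g :: "'a \<Rightarrow> 'b::{banach,second_countable_topology}"
  assumes B: "B \<in> sets \<omega>" and g: "set_integrable \<omega> B g" and p: "1 \<le> p" and L: "0 < L"
    and le: "(\<integral>\<^sup>+x\<in>B. ennreal (norm (g x) powr p) \<partial>\<omega>) \<le> ennreal (L powr p) * emeasure \<omega> B"
  shows "(\<integral>\<^sup>+x\<in>B. ennreal (norm (g x)) \<partial>\<omega>) \<le> ennreal (2 * L) * emeasure \<omega> B"
proof -
  have pt: "u \<le> L + L powr (1 - p) * u powr p" if "0 \<le> u" for u
  proof (cases "u \<le> L")
    case True
    then show ?thesis by (smt (verit) mult_nonneg_nonneg powr_ge_zero)
  next
    case False
    then have u: "L < u" "0 < u" using L by auto
    have "u = u powr (1-p) * u powr p"
      using u by (simp flip: powr_add)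
    also have "\<dots> \<le> L powr (1-p) * u powr p"
      using u L p by (intro mult_right_mono powr_mono2') auto
    finally show ?thesis using L by simp
  qed
  have gm: "(\<lambda>x. indicat_real B x *\<^sub>R g x) \<in> borel_measurable \<omega>"
    using g unfolding set_integrable_def by auto
  have "(\<lambda>x. ennreal (norm (indicat_real B x *\<^sub>R g x) powr p)) \<in> borel_measurable \<omega>"
    using gm by measurable
  also have "(\<lambda>x. ennreal (norm (indicat_real B x *\<^sub>R g x) powr p))
     = (\<lambda>x. ennreal (norm (g x) powr p) * indicator B x)"
    using p by (auto simp: indicator_def fun_eq_iff)
  finally have m: "(\<lambda>x. ennreal (norm (g x) powr p) * indicator B x) \<in> borel_measurable \<omega>" .
  have "(\<integral>\<^sup>+x\<in>B. ennreal (norm (g x)) \<partial>\<omega>)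
     \<le> (\<integral>\<^sup>+x. ennreal L * indicator B x
          + ennreal (L powr (1-p)) * (ennreal (norm (g x) powr p) * indicator B x) \<partial>\<omega>)"
  proof (intro nn_integral_mono)
    fix x
    have "ennreal (norm (g x)) \<le> ennreal (L + L powr (1 - p) * norm (g x) powr p)"
      using pt[of "norm (g x)"] by (intro ennreal_leI) auto
    also have "\<dots> = ennreal L + ennreal (L powr (1-p)) * ennreal (norm (g x) powr p)"
      using L by (simp add: ennreal_mult)
    finally show "ennreal (norm (g x)) * indicator B x \<le> ennreal L * indicator B x
          + ennreal (L powr (1-p)) * (ennreal (norm (g x) powr p) * indicator B x)"
      by (auto simp: indicator_def)
  qed
  also have "\<dots> = ennreal L * emeasure \<omega> B
      + ennreal (L powr (1-p)) * (\<integral>\<^sup>+x\<in>B. ennreal (norm (g x) powr p) \<partial>\<omega>)"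
    using B m by (subst nn_integral_add) (auto simp: nn_integral_cmult)
  also have "\<dots> \<le> ennreal L * emeasure \<omega> B
      + ennreal (L powr (1-p)) * (ennreal (L powr p) * emeasure \<omega> B)"
    using le by (intro add_left_mono mult_left_mono) auto
  also have "ennreal (L powr (1-p)) * (ennreal (L powr p) * emeasure \<omega> B)
      = ennreal L * emeasure \<omega> B"
    using L by (simp add: mult.assoc[symmetric] flip: ennreal_mult powr_add)
  also have "ennreal L * emeasure \<omega> B + ennreal L * emeasure \<omega> B = ennreal (2 * L) * emeasure \<omega> B"
    using L by (simp flip: distrib_right ennreal_plus)
  finally show ?thesis .
qed

lemma mean_le_of_powr:
  fixes g :: "'a \<Rightarrow> 'b::{banach,second_countable_topology}"
  assumes B: "B \<in> sets \<omega>" and g: "set_integrable \<omega> B g" and p: "1 \<le> p" and L: "0 \<le> L"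
    and fin: "emeasure \<omega> B < \<infinity>" and pos: "0 < emeasure \<omega> B"
    and le: "(\<integral>\<^sup>+x\<in>B. ennreal (norm (g x) powr p) \<partial>\<omega>) \<le> ennreal (L powr p) * emeasure \<omega> B"
  shows "mean \<omega> B (\<lambda>x. norm (g x)) \<le> 2 * L"
proof (rule field_le_epsilon)
  fix e :: real assume "0 < e"
  \<comment> \<open>\<open>set_nn_integral_le_of_powr\<close> asks for a positive bound, and \<open>L\<close> may vanish.\<close>
  define L' where "L' = L + e / 2"
  have L': "0 < L'" "L \<le> L'" unfolding L'_def using L \<open>0 < e\<close> by auto
  have m: "measure \<omega> B > 0" and e: "emeasure \<omega> B = ennreal (measure \<omega> B)"
    using fin pos by (auto simp: measure_def enn2real_positive_iff)
  note le
  also have "ennreal (L powr p) * emeasure \<omega> B \<le> ennreal (L' powr p) * emeasure \<omega> B"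
    using L L' p by (intro mult_right_mono ennreal_leI powr_mono2) auto
  finally have "ennreal (measure \<omega> B * mean \<omega> B (\<lambda>x. norm (g x))) \<le> ennreal (measure \<omega> B * (2 * L'))"
    using set_nn_integral_le_of_powr[OF B g p L'(1)] m L'
    unfolding set_nn_integral_norm_eq_mean[OF g fin pos] e
    by (simp add: ennreal_mult[symmetric] mult.commute)
  then have "mean \<omega> B (\<lambda>x. norm (g x)) \<le> 2 * L'"
    using m L' by (simp add: ennreal_le_iff)
  then show "mean \<omega> B (\<lambda>x. norm (g x)) \<le> 2 * L + e" unfolding L'_def by simp
qed

text \<open>Moving the centre by at most \<open>L\<close> keeps an \<open>L\<^sup>p\<close> bound \<open>L\<close> up to the factor \<open>4\<close>; this replaces
  Minkowski's inequality. It rests on \<open>(u + L)\<^bsup>p\<^esup> \<le> 2\<^bsup>p\<^esup> (u\<^bsup>p\<^esup> + L\<^bsup>p\<^esup>)\<close> and \<open>2 \<le> 2\<^bsup>p\<^esup>\<close>.\<close>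

lemma set_nn_integral_powr_shift:
  fixes f :: "'a \<Rightarrow> 'b::{banach,second_countable_topology}"
  assumes B: "B \<in> sets \<omega>" and f: "set_integrable \<omega> B f" and p: "1 \<le> p" and L: "0 \<le> L"
    and le: "(\<integral>\<^sup>+y\<in>B. ennreal (norm (f y - a) powr p) \<partial>\<omega>) \<le> ennreal (L powr p) * emeasure \<omega> B"
    and ab: "norm (a - b) \<le> L"
  shows "(\<integral>\<^sup>+y\<in>B. ennreal (norm (f y - b) powr p) \<partial>\<omega>) \<le> ennreal ((4 * L) powr p) * emeasure \<omega> B"
proof -
  have pt: "norm (f y - b) powr p \<le> 2 powr p * (norm (f y - a) powr p + L powr p)" for y
  proof -
    have "norm (f y - b) \<le> norm (f y - a) + norm (a - b)"
      using norm_triangle_ineq[of "f y - a" "a - b"] by simp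
    also have "\<dots> \<le> 2 * max (norm (f y - a)) L"
      using ab by simp
    finally have "norm (f y - b) powr p \<le> (2 * max (norm (f y - a)) L) powr p"
      using p by (intro powr_mono2) auto
    also have "\<dots> = 2 powr p * max (norm (f y - a)) L powr p"
      using L by (simp add: powr_mult)
    also have "\<dots> \<le> 2 powr p * (norm (f y - a) powr p + L powr p)"
      by (intro mult_left_mono) (auto simp: max_def)
    finally show ?thesis .
  qed
  have "(\<lambda>y. ennreal (norm (indicat_real B y *\<^sub>R f y - indicat_real B y *\<^sub>R a) powr p)) \<in> borel_measurable \<omega>"
    using borel_measurable_integrable[OF f[unfolded set_integrable_def]] B by measurable
  also have "(\<lambda>y. ennreal (norm (indicat_real B y *\<^sub>R f y - indicat_real B y *\<^sub>R a) powr p))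
     = (\<lambda>y. ennreal (norm (f y - a) powr p) * indicator B y)"
    using p by (auto simp: indicator_def fun_eq_iff)
  finally have m: "(\<lambda>y. ennreal (norm (f y - a) powr p) * indicator B y) \<in> borel_measurable \<omega>" .
  have "(\<integral>\<^sup>+y\<in>B. ennreal (norm (f y - b) powr p) \<partial>\<omega>)
    \<le> (\<integral>\<^sup>+y. ennreal (2 powr p) * (ennreal (norm (f y - a) powr p) * indicator B y
           + ennreal (L powr p) * indicator B y) \<partial>\<omega>)"
  proof (intro nn_integral_mono)
    fix y
    have "ennreal (norm (f y - b) powr p) \<le> ennreal (2 powr p * (norm (f y - a) powr p + L powr p))"
      by (intro ennreal_leI pt)
    also have "\<dots> = ennreal (2 powr p) * (ennreal (norm (f y - a) powr p) + ennreal (L powr p))"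
      by (simp add: ennreal_mult)
    finally show "ennreal (norm (f y - b) powr p) * indicator B y
      \<le> ennreal (2 powr p) * (ennreal (norm (f y - a) powr p) * indicator B y
           + ennreal (L powr p) * indicator B y)"
      by (auto simp: indicator_def)
  qed
  also have "\<dots> = ennreal (2 powr p) * ((\<integral>\<^sup>+y\<in>B. ennreal (norm (f y - a) powr p) \<partial>\<omega>)
           + ennreal (L powr p) * emeasure \<omega> B)"
    using m B by (simp add: nn_integral_cmult nn_integral_add nn_integral_cmult_indicator)
  also have "\<dots> \<le> ennreal (2 powr p) * (ennreal (L powr p) * emeasure \<omega> B + ennreal (L powr p) * emeasure \<omega> B)"
    using le by (intro mult_left_mono add_right_mono) auto
  also have "\<dots> = ennreal (2 powr p * (2 * L powr p)) * emeasure \<omega> B"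
    by (simp add: ennreal_mult mult.assoc flip: mult_2)
  also have "\<dots> \<le> ennreal ((4 * L) powr p) * emeasure \<omega> B"
  proof (intro mult_right_mono ennreal_leI)
    have "2 * L powr p \<le> 2 powr p * L powr p"
      using p powr_mono[of 1 p 2] by (intro mult_right_mono) auto
    then have "2 powr p * (2 * L powr p) \<le> 2 powr p * (2 powr p * L powr p)"
      by (intro mult_left_mono) auto
    also have "\<dots> = (4 * L) powr p"
      using L by (simp add: powr_mult[symmetric] mult.assoc[symmetric])
    finally show "2 powr p * (2 * L powr p) \<le> (4 * L) powr p" .
  qed simp
  finally show ?thesis .
qed

section \<open>The John-Nirenberg inequality for nested partitions\<close>

text \<open>The layer-cake sum for a function whose superlevel sets at the heights \<open>t(2 + D)\<close> have relative
  measure at most \<open>2\<^bsup>-t\<^esup>\<close>.\<close>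

definition john_nirenberg_const :: "real \<Rightarrow> real \<Rightarrow> real" where
  "john_nirenberg_const D p = (\<Sum>t. (real (Suc t) * (2 + D)) powr p * (1/2) ^ t)"

lemma summable_john_nirenberg_const: "summable (\<lambda>t. (real (Suc t) * (2 + D)) powr p * (1/2) ^ t)"
proof -
  have "summable (\<lambda>t. real (Suc t) powr p * (1/2) ^ t)"
  proof (rule summable_comparison_test_bigo)
    show "summable (\<lambda>t. norm ((3/4) ^ t :: real))"
      by (simp add: summable_geometric)
    show "(\<lambda>t. real (Suc t) powr p * (1/2) ^ t) \<in> O(\<lambda>t. (3/4) ^ t)"
      by real_asymp
  qed
  then have "summable (\<lambda>t. (2 + D) powr p * (real (Suc t) powr p * (1/2) ^ t))"
    by (rule summable_mult)
  moreover have "(real (Suc t) * (2 + D)) powr p * (1/2) ^ t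
    = (2 + D) powr p * (real (Suc t) powr p * (1/2) ^ t)" for t
    by (simp add: powr_mult)
  ultimately show ?thesis by (simp only:)
qed

lemma john_nirenberg_const_nonneg: "0 \<le> john_nirenberg_const D p"
  unfolding john_nirenberg_const_def by (intro suminf_nonneg summable_john_nirenberg_const) auto

text \<open>\<open>cell n y\<close> is the cell of the \<open>n\<close>-th partition that contains \<open>y\<close>. The last assumption is all
  that is needed of the topology: measurable sets are approximated from outside by unions of
  cells. For a grid it combines outer regularity with the shrinking of the cells.\<close>

locale nested_cells =
  fixes \<omega> :: "'a measure" and cell :: "nat \<Rightarrow> 'a \<Rightarrow> 'a set" and D :: real
  assumes cell_refl: "y \<in> cell n y"
    and cell_eq: "z \<in> cell n y \<Longrightarrow> cell n z = cell n y"
    and cell_Suc: "cell (Suc n) y \<subseteq> cell n y"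
    and cell_sets: "cell n y \<in> sets \<omega>"
    and cell_countable: "countable (range (cell n))"
    and cell_finite: "emeasure \<omega> (cell n y) < \<infinity>"
    and cell_pos: "0 < emeasure \<omega> (cell n y)"
    and cell_doubling: "measure \<omega> (cell n y) \<le> D * measure \<omega> (cell (Suc n) y)"
    and cell_hull: "F \<in> sets \<omega> \<Longrightarrow> F \<subseteq> cell m x \<Longrightarrow> 0 < e \<Longrightarrow>
      \<exists>U\<in>sets \<omega>. F \<subseteq> U \<and> U \<subseteq> cell m x \<and> emeasure \<omega> (U - F) \<le> ennreal e
        \<and> (\<forall>y\<in>U. \<exists>n\<ge>m. cell n y \<subseteq> U)"
begin

lemma cell_antimono: "m \<le> n \<Longrightarrow> cell n y \<subseteq> cell m y"
  by (induction n rule: dec_induct) (use cell_Suc in blast)+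

lemma cell_sym: "z \<in> cell n y \<Longrightarrow> y \<in> cell n z"
  using cell_eq cell_refl by blast

lemma measure_cell_pos: "0 < measure \<omega> (cell n y)"
  using cell_finite[of n y] cell_pos[of n y] by (simp add: measure_def enn2real_positive_iff)

lemma level_sets_measurable:
  assumes P: "\<And>y z. P y \<Longrightarrow> z \<in> cell n y \<Longrightarrow> P z"
  shows "{y. P y} \<in> sets \<omega>"
proof -
  have "{y. P y} = \<Union>{c \<in> range (cell n). c \<subseteq> {y. P y}}"
    using P cell_refl by auto blast
  also have "\<dots> \<in> sets \<omega>"
    using cell_sets by (intro sets.countable_Union countable_subset[OF _ cell_countable[of n]]) auto
  finally show ?thesis .
qed

text \<open>The part of a cell on which a stopping rule \<open>P\<close> applies at some level from \<open>m\<close> on. In all uses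
  \<open>P n\<close> is constant on the cells of level \<open>n\<close>.\<close>

definition hits :: "(nat \<Rightarrow> 'a \<Rightarrow> bool) \<Rightarrow> nat \<Rightarrow> 'a \<Rightarrow> 'a set" where
  "hits P m x = {y \<in> cell m x. \<exists>n\<ge>m. P n y}"

lemma hits_sets:
  assumes P: "\<And>n y z. P n y \<Longrightarrow> z \<in> cell n y \<Longrightarrow> P n z"
  shows "hits P m x \<in> sets \<omega>"
proof -
  have level: "{y. P n y} \<in> sets \<omega>" for n
    using P by (rule level_sets_measurable)
  have "hits P m x = (\<Union>n\<in>{m..}. cell m x \<inter> {y. P n y})"
    unfolding hits_def by auto
  also have "\<dots> \<in> sets \<omega>"
    by (rule sets.countable_UN') (use sets.Int[OF cell_sets level] in blast)+
  finally show ?thesis .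
qed

text \<open>The set on which the rule ever applies is the disjoint union of the cells where it applies for
  the first time, and there are countably many of them. So an inequality between integrals over
  these cells adds up.\<close>

lemma first_hit_decomposition:
  fixes g1 g2 :: "'a \<Rightarrow> ennreal"
  assumes g1: "g1 \<in> borel_measurable \<omega>" and g2: "g2 \<in> borel_measurable \<omega>"
    and P: "\<And>n y z. P n y \<Longrightarrow> z \<in> cell n y \<Longrightarrow> P n z"
    and le: "\<And>n y. m \<le> n \<Longrightarrow> y \<in> cell m x \<Longrightarrow> P n y \<Longrightarrow> (\<forall>i. m \<le> i \<and> i < n \<longrightarrow> \<not> P i y) \<Longrightarrow>
      (\<integral>\<^sup>+z\<in>cell n y. g1 z \<partial>\<omega>) \<le> (\<integral>\<^sup>+z\<in>cell n y. g2 z \<partial>\<omega>)"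
  shows "(\<integral>\<^sup>+z\<in>hits P m x. g1 z \<partial>\<omega>) \<le> (\<integral>\<^sup>+z\<in>hits P m x. g2 z \<partial>\<omega>)"
proof -
  define first where
    "first n y \<longleftrightarrow> m \<le> n \<and> y \<in> cell m x \<and> P n y \<and> (\<forall>i. m \<le> i \<and> i < n \<longrightarrow> \<not> P i y)" for n y
  define T where "T = {cell n y | n y. first n y}"
  have T_sets: "c \<in> sets \<omega>" if "c \<in> T" for c
    using that cell_sets unfolding T_def by auto
  have "T \<subseteq> (\<Union>n. range (cell n))"
    unfolding T_def by auto
  then have T_count: "countable T"
    by (rule countable_subset) (use cell_countable in auto)
  have hits_eq: "hits P m x = \<Union>T"
  proof (intro set_eqI iffI)
    fix y assume "y \<in> hits P m x"
    then obtain n where n: "y \<in> cell m x" "m \<le> n" "P n y"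
      unfolding hits_def by auto
    define N where "N = (LEAST n. m \<le> n \<and> P n y)"
    have "m \<le> N \<and> P N y"
      unfolding N_def by (rule LeastI) (use n in auto)
    moreover have "\<not> P i y" if "m \<le> i" "i < N" for i
      using not_less_Least[of i "\<lambda>n. m \<le> n \<and> P n y"] that unfolding N_def by auto
    ultimately have "first N y"
      using n unfolding first_def by auto
    then show "y \<in> \<Union>T"
      unfolding T_def using cell_refl by blast
  next
    fix z assume "z \<in> \<Union>T"
    then obtain n y where ny: "first n y" "z \<in> cell n y"
      unfolding T_def by blast
    then have "z \<in> cell m y" using cell_antimono[of m n y] unfolding first_def by auto
    moreover have "cell m y = cell m x" using ny cell_eq unfolding first_def by blast
    ultimately show "z \<in> hits P m x"
      using ny P unfolding hits_def first_def by blast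
  qed
  have same: "cell n y = cell n' y'" if "first n y" "first n' y'" "z \<in> cell n y" "z \<in> cell n' y'" "n \<le> n'"
    for n n' y y' z
  proof -
    have "P n z" using that P unfolding first_def by blast
    moreover have "y' \<in> cell n z"
      using that cell_sym[of z n' y'] cell_antimono[of n n' z] by blast
    ultimately have "P n y'" using P by blast
    then have "n = n'" using that unfolding first_def by force
    then show ?thesis using that cell_eq by blast
  qed
  have disj: "disjoint_family_on (\<lambda>c. c) T"
  proof (unfold disjoint_family_on_def, intro ballI impI)
    fix c c' assume c: "c \<in> T" "c' \<in> T" "c \<noteq> c'"
    then obtain n y n' y' where *: "c = cell n y" "first n y" "c' = cell n' y'" "first n' y'"
      unfolding T_def by blast
    have "z \<notin> c'" if "z \<in> c" for z
      using same[of n y n' y' z] same[of n' y' n y z] * c that by (cases "n \<le> n'") auto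
    then show "c \<inter> c' = {}" by blast
  qed
  have sum: "(\<integral>\<^sup>+z\<in>\<Union>T. g z \<partial>\<omega>) = (\<integral>\<^sup>+c. (\<integral>\<^sup>+z\<in>c. g z \<partial>\<omega>) \<partial>count_space T)"
    if g: "g \<in> borel_measurable \<omega>" for g
  proof -
    have "emeasure (density \<omega> g) (\<Union>c\<in>T. c) = (\<integral>\<^sup>+c. emeasure (density \<omega> g) c \<partial>count_space T)"
      using T_sets T_count disj by (intro emeasure_UN_countable) auto
    also have "\<dots> = (\<integral>\<^sup>+c. (\<integral>\<^sup>+z\<in>c. g z \<partial>\<omega>) \<partial>count_space T)"
      using T_sets g by (intro nn_integral_cong) (auto simp: emeasure_density)
    finally show ?thesis
      using T_sets T_count g by (subst (asm) emeasure_density) (auto intro!: sets.countable_Union)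
  qed
  show ?thesis
    unfolding hits_eq sum[OF g1] sum[OF g2]
  proof (rule nn_integral_mono)
    fix c assume "c \<in> space (count_space T)"
    then show "(\<integral>\<^sup>+z\<in>c. g1 z \<partial>\<omega>) \<le> (\<integral>\<^sup>+z\<in>c. g2 z \<partial>\<omega>)"
      using le unfolding T_def first_def by auto
  qed
qed

text \<open>This is the only differentiation property used. Cover \<open>F\<close> by a union \<open>U\<close> of cells with
  \<open>\<omega>(U) \<le> \<omega>(F) + e\<close> and sum over the maximal cells inside \<open>U\<close>: then \<open>\<omega>(F) \<le> \<omega>(U)/2\<close>,
  so \<open>\<omega>(F) \<le> e\<close>.\<close>

lemma null_if_half_density:
  assumes F: "F \<in> sets \<omega>" "F \<subseteq> cell m x"
    and half: "\<And>n y. m \<le> n \<Longrightarrow> y \<in> cell m x \<Longrightarrow>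
      emeasure \<omega> (F \<inter> cell n y) \<le> ennreal (1/2) * emeasure \<omega> (cell n y)"
  shows "emeasure \<omega> F = 0"
proof -
  have finF: "emeasure \<omega> F < \<infinity>"
    using emeasure_mono[OF F(2) cell_sets] cell_finite[of m x] by (rule order_le_less_trans)
  have bnd: "measure \<omega> F \<le> e" if e: "0 < e" for e
  proof -
    obtain U where U: "U \<in> sets \<omega>" "F \<subseteq> U" "U \<subseteq> cell m x" "emeasure \<omega> (U - F) \<le> ennreal e"
      "\<forall>y\<in>U. \<exists>n\<ge>m. cell n y \<subseteq> U"
      using cell_hull[OF F e] by blast
    define P where "P n y \<longleftrightarrow> cell n y \<subseteq> U" for n y
    have hU: "hits P m x = U"
    proof
      show "hits P m x \<subseteq> U"
        unfolding hits_def P_def using cell_refl by blast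
      show "U \<subseteq> hits P m x"
        unfolding hits_def P_def using U by blast
    qed
    have "(\<integral>\<^sup>+z\<in>hits P m x. indicator F z \<partial>\<omega>) \<le> (\<integral>\<^sup>+z\<in>hits P m x. ennreal (1/2) \<partial>\<omega>)"
    proof (rule first_hit_decomposition)
      show "\<And>n y z. P n y \<Longrightarrow> z \<in> cell n y \<Longrightarrow> P n z"
        unfolding P_def using cell_eq by blast
      fix n y assume "m \<le> n" "y \<in> cell m x"
      have "(\<integral>\<^sup>+z\<in>cell n y. indicator F z \<partial>\<omega>) = emeasure \<omega> (F \<inter> cell n y)"
        using F cell_sets by (simp flip: indicator_inter_arith)
      also have "\<dots> \<le> (\<integral>\<^sup>+z\<in>cell n y. ennreal (1/2) \<partial>\<omega>)"
        using half[OF \<open>m \<le> n\<close> \<open>y \<in> cell m x\<close>] cell_sets[of n y] by (simp add: nn_integral_cmult_indicator)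
      finally show "(\<integral>\<^sup>+z\<in>cell n y. indicator F z \<partial>\<omega>) \<le> (\<integral>\<^sup>+z\<in>cell n y. ennreal (1/2) \<partial>\<omega>)" .
    qed (use F in auto)
    moreover have "(\<integral>\<^sup>+z\<in>U. indicator F z \<partial>\<omega>) = emeasure \<omega> F"
      using F U by (simp add: Int_absorb2 flip: indicator_inter_arith)
    ultimately have 1: "emeasure \<omega> F \<le> ennreal (1/2) * emeasure \<omega> U"
      using U(1) by (simp add: hU nn_integral_cmult_indicator)
    have "emeasure \<omega> U = emeasure \<omega> F + emeasure \<omega> (U - F)"
      using U F by (subst plus_emeasure) (auto intro!: arg_cong[where f="emeasure \<omega>"])
    also have "\<dots> \<le> emeasure \<omega> F + ennreal e"
      using U by (intro add_left_mono) auto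
    finally have "emeasure \<omega> F \<le> ennreal (1/2) * (emeasure \<omega> F + ennreal e)"
      using 1 by (meson mult_left_mono order_trans zero_le)
    then have "ennreal (measure \<omega> F) \<le> ennreal (1/2 * (measure \<omega> F + e))"
      using finF e by (simp add: emeasure_eq_ennreal_measure ennreal_plus[symmetric] ennreal_mult[symmetric]
          del: ennreal_plus ennreal_half)
    then show ?thesis using e by (simp add: ennreal_le_iff)
  qed
  then have "measure \<omega> F \<le> 0"
    using field_le_epsilon[of "measure \<omega> F" 0] by simp
  then show ?thesis
    using finF measure_nonneg[of \<omega> F] by (simp add: emeasure_eq_ennreal_measure)
qed

context
  fixes f :: "'a \<Rightarrow> 'b::{banach,second_countable_topology}" and A :: real
  assumes f_meas: "f \<in> borel_measurable \<omega>"
    and f_int: "\<And>n y. set_integrable \<omega> (cell n y) f"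
    and A: "0 < A" and D2: "2 \<le> D"
    and osc: "\<And>n y. mean \<omega> (cell n y) (\<lambda>z. norm (f z - mean \<omega> (cell n y) f)) \<le> A"
begin

lemma mean_cell_jump: "norm (mean \<omega> (cell (Suc n) y) f - mean \<omega> (cell n y) f) \<le> D * A"
proof -
  let ?a = "mean \<omega> (cell n y) f"
  have "norm (mean \<omega> (cell (Suc n) y) f - ?a) \<le> mean \<omega> (cell (Suc n) y) (\<lambda>z. norm (f z - ?a))"
    by (intro norm_mean_diff_le f_int cell_sets cell_finite cell_pos)
  also have "\<dots> \<le> D * mean \<omega> (cell n y) (\<lambda>z. norm (f z - ?a))"
    by (intro mean_norm_mono_set set_integrable_diff_const f_int cell_Suc cell_sets cell_finite
          measure_cell_pos cell_doubling)
  also have "\<dots> \<le> D * A"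
    using osc D2 by (intro mult_left_mono) auto
  finally show ?thesis .
qed

lemma osc_nn_integral:
  "(\<integral>\<^sup>+z\<in>cell n y. ennreal (norm (f z - mean \<omega> (cell n y) f)) \<partial>\<omega>) \<le> ennreal A * emeasure \<omega> (cell n y)"
proof -
  have "(\<integral>\<^sup>+z\<in>cell n y. ennreal (norm (f z - mean \<omega> (cell n y) f)) \<partial>\<omega>)
     = ennreal (measure \<omega> (cell n y) * mean \<omega> (cell n y) (\<lambda>z. norm (f z - mean \<omega> (cell n y) f)))"
    by (intro set_nn_integral_norm_eq_mean set_integrable_diff_const f_int cell_sets cell_finite cell_pos)
  also have "\<dots> \<le> ennreal (measure \<omega> (cell n y) * A)"
    using osc[of n y] by (intro ennreal_leI mult_left_mono) auto
  also have "\<dots> = ennreal A * emeasure \<omega> (cell n y)"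
    using A cell_finite[of n y] by (simp add: emeasure_eq_ennreal_measure ennreal_mult mult.commute)
  finally show ?thesis .
qed

lemma superlevel_sets: "{z. s < norm (f z - a)} \<inter> cell n y \<in> sets \<omega>"
proof -
  have "{z \<in> space \<omega>. s < norm (f z - a)} \<inter> cell n y \<in> sets \<omega>"
    using f_meas by (intro sets.Int cell_sets) measurable
  moreover have "{z \<in> space \<omega>. s < norm (f z - a)} \<inter> cell n y = {z. s < norm (f z - a)} \<inter> cell n y"
    using sets.sets_into_space[OF cell_sets[of n y]] by auto
  ultimately show ?thesis by simp
qed

definition deviates :: "'b \<Rightarrow> nat \<Rightarrow> 'a \<Rightarrow> bool" where
  "deviates a n y \<longleftrightarrow> 2 * A < norm (mean \<omega> (cell n y) f - a)"

lemma deviates_cell: "deviates a n y \<Longrightarrow> z \<in> cell n y \<Longrightarrow> deviates a n z"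
  unfolding deviates_def using cell_eq by metis

lemma hits_deviates_sets: "hits (deviates a) m x \<in> sets \<omega>"
  by (rule hits_sets) (rule deviates_cell)

text \<open>On a first stopped cell \<open>|f - a|\<close> has mean above \<open>2A\<close>, while its mean on the whole cell is at
  most \<open>A\<close>; hence the stopped cells take up at most half.\<close>

lemma hits_deviates_measure:
  "emeasure \<omega> (hits (deviates (mean \<omega> (cell m x) f)) m x) \<le> ennreal (1/2) * emeasure \<omega> (cell m x)"
proof -
  define a where "a = mean \<omega> (cell m x) f"
  let ?E = "hits (deviates a) m x"
  have E: "?E \<in> sets \<omega>" "?E \<subseteq> cell m x"
    by (rule hits_deviates_sets) (auto simp: hits_def)
  have "(\<integral>\<^sup>+z\<in>?E. ennreal (2 * A) \<partial>\<omega>) \<le> (\<integral>\<^sup>+z\<in>?E. ennreal (norm (f z - a)) \<partial>\<omega>)"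
  proof (rule first_hit_decomposition)
    fix n y assume "deviates a n y"
    then have "2 * A \<le> norm (mean \<omega> (cell n y) f - a)"
      unfolding deviates_def by simp
    also have "\<dots> \<le> mean \<omega> (cell n y) (\<lambda>z. norm (f z - a))"
      by (intro norm_mean_diff_le f_int cell_sets cell_finite cell_pos)
    finally have "2 * A * measure \<omega> (cell n y)
      \<le> mean \<omega> (cell n y) (\<lambda>z. norm (f z - a)) * measure \<omega> (cell n y)"
      by (rule mult_right_mono) simp
    then have "ennreal (2 * A) * ennreal (measure \<omega> (cell n y))
      \<le> ennreal (measure \<omega> (cell n y) * mean \<omega> (cell n y) (\<lambda>z. norm (f z - a)))"
      using A by (subst ennreal_mult[symmetric]) (auto intro: ennreal_leI simp: mult.commute)
    also have "\<dots> = (\<integral>\<^sup>+z\<in>cell n y. ennreal (norm (f z - a)) \<partial>\<omega>)"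
      by (intro set_nn_integral_norm_eq_mean[symmetric] set_integrable_diff_const f_int cell_sets
            cell_finite cell_pos)
    finally show "(\<integral>\<^sup>+z\<in>cell n y. ennreal (2 * A) \<partial>\<omega>) \<le> (\<integral>\<^sup>+z\<in>cell n y. ennreal (norm (f z - a)) \<partial>\<omega>)"
      using cell_finite[of n y] cell_sets[of n y]
      by (simp add: nn_integral_cmult_indicator emeasure_eq_ennreal_measure)
    next
    show "deviates a n z" if "deviates a n y" "z \<in> cell n y" for n y z
      using that by (rule deviates_cell)
  qed (use f_meas in measurable)
  also have "\<dots> \<le> (\<integral>\<^sup>+z\<in>cell m x. ennreal (norm (f z - a)) \<partial>\<omega>)"
    using E by (intro nn_integral_mono) (auto simp: indicator_def)
  also have "\<dots> \<le> ennreal A * emeasure \<omega> (cell m x)"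
    unfolding a_def by (rule osc_nn_integral)
  finally have *: "ennreal (2 * A) * emeasure \<omega> ?E \<le> ennreal A * emeasure \<omega> (cell m x)"
    using E by (simp add: nn_integral_cmult_indicator)
  have finE: "emeasure \<omega> ?E < \<infinity>"
    using emeasure_mono[OF E(2) cell_sets] cell_finite[of m x] by (rule order_le_less_trans)
  then have e: "emeasure \<omega> ?E = ennreal (measure \<omega> ?E)"
    by (simp add: emeasure_eq_ennreal_measure)
  have c: "emeasure \<omega> (cell m x) = ennreal (measure \<omega> (cell m x))"
    using cell_finite[of m x] by (simp add: emeasure_eq_ennreal_measure)
  have "2 * A * measure \<omega> ?E \<le> A * measure \<omega> (cell m x)"
    using * A unfolding e c by (simp flip: ennreal_mult)
  then have "measure \<omega> ?E \<le> 1/2 * measure \<omega> (cell m x)"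
    using A by simp
  then have "emeasure \<omega> ?E \<le> ennreal (1/2) * emeasure \<omega> (cell m x)"
    unfolding e c by (simp flip: ennreal_mult del: ennreal_half)
  then show ?thesis unfolding a_def .
qed

text \<open>If \<open>z\<close> is never stopped, then all cells around \<open>z\<close> have means within \<open>2A\<close> of the starting mean
  \<open>a\<close>. Points of such a cell with \<open>|f - a| > (2 + D) A \<ge> 4A\<close> deviate from the mean of the
  cell by at least \<open>2A\<close>, so by Chebyshev's inequality they fill at most half of it.\<close>

lemma no_deviation_off_hits:
  "emeasure \<omega> ({z. (2 + D) * A < norm (f z - mean \<omega> (cell m x) f)} \<inter> cell m x
      - hits (deviates (mean \<omega> (cell m x) f)) m x) = 0" (is "emeasure \<omega> ?F = 0")
proof (rule null_if_half_density)
  define a where "a = mean \<omega> (cell m x) f"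
  show F: "?F \<in> sets \<omega>"
    by (rule sets.Diff[OF superlevel_sets hits_deviates_sets])
  show "?F \<subseteq> cell m x" by blast
  fix n y assume n: "m \<le> n" and y: "y \<in> cell m x"
  show "emeasure \<omega> (?F \<inter> cell n y) \<le> ennreal (1/2) * emeasure \<omega> (cell n y)"
  proof (cases "?F \<inter> cell n y = {}")
    case False
    then obtain z where z: "z \<in> ?F" "z \<in> cell n y" by blast
    then have "\<not> deviates a n z"
      using n unfolding hits_def a_def by blast
    then have close: "norm (mean \<omega> (cell n y) f - a) \<le> 2 * A"
      using cell_eq[OF z(2)] unfolding deviates_def by simp
    let ?b = "mean \<omega> (cell n y) f"
    have pt: "2 * A \<le> norm (f u - ?b)" if "u \<in> ?F" for u
    proof -
      have "4 * A \<le> (2 + D) * A" using A D2 by (intro mult_right_mono) auto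
      also have "\<dots> \<le> norm (f u - a)" using that unfolding a_def by auto
      also have "\<dots> \<le> norm (f u - ?b) + norm (?b - a)"
        using norm_triangle_ineq[of "f u - ?b" "?b - a"] by simp
      finally show ?thesis using close by simp
    qed
    have Fs: "?F \<inter> cell n y \<in> sets \<omega>" using F cell_sets by blast
    have "ennreal (2 * A) * emeasure \<omega> (?F \<inter> cell n y) = (\<integral>\<^sup>+u\<in>?F \<inter> cell n y. ennreal (2 * A) \<partial>\<omega>)"
      using Fs by (simp add: nn_integral_cmult_indicator)
    also have "\<dots> \<le> (\<integral>\<^sup>+u\<in>cell n y. ennreal (norm (f u - ?b)) \<partial>\<omega>)"
      using pt by (intro nn_integral_mono) (auto simp: indicator_def ennreal_leI)
    also have "\<dots> \<le> ennreal A * emeasure \<omega> (cell n y)"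
      by (rule osc_nn_integral)
    finally have *: "ennreal (2 * A) * emeasure \<omega> (?F \<inter> cell n y) \<le> ennreal A * emeasure \<omega> (cell n y)" .
    have "emeasure \<omega> (?F \<inter> cell n y) < \<infinity>"
      using emeasure_mono[OF Int_lower2 cell_sets] cell_finite[of n y] by (rule order_le_less_trans)
    then have e: "emeasure \<omega> (?F \<inter> cell n y) = ennreal (measure \<omega> (?F \<inter> cell n y))"
      by (simp add: emeasure_eq_ennreal_measure)
    have c: "emeasure \<omega> (cell n y) = ennreal (measure \<omega> (cell n y))"
      using cell_finite[of n y] by (simp add: emeasure_eq_ennreal_measure)
    have "2 * A * measure \<omega> (?F \<inter> cell n y) \<le> A * measure \<omega> (cell n y)"
      using * A unfolding e c by (simp flip: ennreal_mult)
    then have "measure \<omega> (?F \<inter> cell n y) \<le> 1/2 * measure \<omega> (cell n y)"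
      using A by simp
    then show ?thesis
      unfolding e c by (simp flip: ennreal_mult del: ennreal_half)
  qed simp
qed

text \<open>Induction on \<open>t\<close>, for all cells at once. Up to a null set, a deviation above \<open>(t+1)K\<close> with
  \<open>K = (2 + D) A\<close> occurs only in stopped cells. Just before it is stopped the mean is within \<open>2A\<close> of
  the starting one and the last step adds at most \<open>DA\<close>, so relative to the mean of the stopped
  cell the deviation still exceeds \<open>tK\<close>. The stopped cells contribute the factor \<open>1/2\<close>.\<close>

lemma john_nirenberg_tail:
  "emeasure \<omega> ({z. real t * ((2 + D) * A) < norm (f z - mean \<omega> (cell m x) f)} \<inter> cell m x)
     \<le> ennreal ((1/2) ^ t) * emeasure \<omega> (cell m x)"
proof (induction t arbitrary: m x)
  case 0
  show ?case by (auto intro!: emeasure_mono cell_sets)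
next
  case (Suc t)
  define a where "a = mean \<omega> (cell m x) f"
  define K where "K = (2 + D) * A"
  define E where "E = hits (deviates a) m x"
  define S where "S = {z. real (Suc t) * K < norm (f z - a)} \<inter> cell m x"
  define F where "F = {z. K < norm (f z - a)} \<inter> cell m x - E"
  have K: "K > 0" unfolding K_def using A D2 by simp
  have S: "S \<in> sets \<omega>" unfolding S_def by (rule superlevel_sets)
  have E: "E \<in> sets \<omega>" unfolding E_def by (rule hits_deviates_sets)
  have F0: "emeasure \<omega> F = 0"
    unfolding F_def K_def E_def a_def by (rule no_deviation_off_hits)
  have Fs: "F \<in> sets \<omega>"
    unfolding F_def by (rule sets.Diff[OF superlevel_sets E])
  have "K \<le> real (Suc t) * K" using K by simp
  then have SF: "S \<subseteq> F \<union> (S \<inter> E)"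
    unfolding S_def F_def by auto
  have "(\<integral>\<^sup>+z\<in>E. indicator S z \<partial>\<omega>) \<le> (\<integral>\<^sup>+z\<in>E. ennreal ((1/2)^t) \<partial>\<omega>)"
    unfolding E_def
  proof (rule first_hit_decomposition)
    fix n y assume n: "m \<le> n" and y: "y \<in> cell m x" and dev: "deviates a n y"
      and first: "\<forall>i. m \<le> i \<and> i < n \<longrightarrow> \<not> deviates a i y"
    have "n \<noteq> m"
      using dev A cell_eq[OF y] unfolding deviates_def a_def by auto
    then obtain n' where n': "n = Suc n'" "m \<le> n'"
      using n by (cases n) auto
    let ?b = "mean \<omega> (cell n y) f"
    have "norm (?b - a) \<le> norm (?b - mean \<omega> (cell n' y) f) + norm (mean \<omega> (cell n' y) f - a)"
      using norm_triangle_ineq[of "?b - mean \<omega> (cell n' y) f" "mean \<omega> (cell n' y) f - a"] by simp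
    also have "\<dots> \<le> D * A + 2 * A"
      using mean_cell_jump[of n' y] first n' unfolding deviates_def by (intro add_mono) auto
    finally have b: "norm (?b - a) \<le> K" unfolding K_def by (simp add: algebra_simps)
    have "S \<inter> cell n y \<subseteq> {z. real t * K < norm (f z - ?b)} \<inter> cell n y"
    proof (intro subsetI)
      fix z assume z: "z \<in> S \<inter> cell n y"
      then have "K + real t * K < norm (f z - a)" unfolding S_def by (auto simp: algebra_simps)
      also have "\<dots> \<le> norm (f z - ?b) + norm (?b - a)"
        using norm_triangle_ineq[of "f z - ?b" "?b - a"] by simp
      finally show "z \<in> {z. real t * K < norm (f z - ?b)} \<inter> cell n y" using b z by auto
    qed
    then have "emeasure \<omega> (S \<inter> cell n y) \<le> emeasure \<omega> ({z. real t * K < norm (f z - ?b)} \<inter> cell n y)"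
      by (intro emeasure_mono superlevel_sets)
    also have "\<dots> \<le> ennreal ((1/2)^t) * emeasure \<omega> (cell n y)"
      using Suc.IH unfolding K_def .
    finally show "(\<integral>\<^sup>+z\<in>cell n y. indicator S z \<partial>\<omega>) \<le> (\<integral>\<^sup>+z\<in>cell n y. ennreal ((1/2)^t) \<partial>\<omega>)"
      using S cell_sets by (simp add: nn_integral_cmult_indicator flip: indicator_inter_arith)
    next
    show "deviates a n z" if "deviates a n y" "z \<in> cell n y" for n y z
      using that by (rule deviates_cell)
  qed (use S in auto)
  then have SE: "emeasure \<omega> (S \<inter> E) \<le> ennreal ((1/2)^t) * emeasure \<omega> E"
    using S E by (simp add: nn_integral_cmult_indicator flip: indicator_inter_arith)
  have "emeasure \<omega> S \<le> emeasure \<omega> (F \<union> (S \<inter> E))"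
    using SF Fs S E by (intro emeasure_mono) auto
  also have "\<dots> \<le> emeasure \<omega> F + emeasure \<omega> (S \<inter> E)"
    using Fs S E by (intro emeasure_subadditive) auto
  also have "\<dots> \<le> ennreal ((1/2)^t) * emeasure \<omega> E"
    using F0 SE by simp
  also have "\<dots> \<le> ennreal ((1/2)^t) * (ennreal (1/2) * emeasure \<omega> (cell m x))"
    using hits_deviates_measure unfolding E_def a_def by (intro mult_left_mono) auto
  also have "\<dots> = ennreal ((1/2)^Suc t) * emeasure \<omega> (cell m x)"
    unfolding mult.assoc[symmetric]
    by (subst ennreal_mult[symmetric]) (simp_all del: ennreal_half add: mult.commute)
  finally show ?case unfolding S_def K_def a_def .
qed

lemma john_nirenberg_Lp:
  assumes p: "1 \<le> p"
  shows "(\<integral>\<^sup>+z\<in>cell m x. ennreal (norm (f z - mean \<omega> (cell m x) f) powr p) \<partial>\<omega>)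
    \<le> ennreal (A powr p * john_nirenberg_const D p) * emeasure \<omega> (cell m x)"
proof -
  define K where "K = (2 + D) * A"
  define u where "u z = norm (f z - mean \<omega> (cell m x) f)" for z
  define S where "S t = {z. real t * K < u z} \<inter> cell m x" for t
  have K: "0 < K" unfolding K_def using A D2 by simp
  have S: "S t \<in> sets \<omega>" for t
    unfolding S_def u_def by (rule superlevel_sets)
  have pt: "ennreal (u z powr p) * indicator (cell m x) z
      \<le> (\<Sum>t. ennreal ((real (Suc t) * K) powr p) * indicator (S t) z)" for z
  proof (cases "z \<in> cell m x \<and> 0 < u z")
    case True
    \<comment> \<open>The layer of \<open>z\<close>: the \<open>t\<close> with \<open>tK < u z \<le> (t+1)K\<close>.\<close>
    define t where "t = nat (\<lceil>u z / K\<rceil> - 1)"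
    have "0 < u z / K" using True K by simp
    then have "real t = of_int \<lceil>u z / K\<rceil> - 1"
      unfolding t_def by (simp add: of_nat_nat)
    then have "real t < u z / K" "u z / K \<le> real (Suc t)"
      by linarith+
    then have t: "real t * K < u z" "u z \<le> real (Suc t) * K"
      using K by (simp_all add: field_simps)
    have "ennreal (u z powr p) * indicator (cell m x) z \<le> ennreal ((real (Suc t) * K) powr p) * indicator (S t) z"
      using True t p unfolding S_def by (auto intro!: ennreal_leI powr_mono2)
    also have "\<dots> = (\<Sum>i\<in>{t}. ennreal ((real (Suc i) * K) powr p) * indicator (S i) z)"
      by (simp only: sum.insert finite.emptyI empty_iff not_False_eq_True sum.empty add_0_right)
    also have "\<dots> \<le> (\<Sum>t. ennreal ((real (Suc t) * K) powr p) * indicator (S t) z)"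
      by (rule sum_le_suminf) auto
    finally show ?thesis .
  next
    case False
    moreover have "0 \<le> u z" unfolding u_def by simp
    ultimately have "ennreal (u z powr p) * indicator (cell m x) z = 0"
      by (cases "u z = 0") (auto simp: indicator_def)
    then show ?thesis by (simp only: zero_le)
  qed
  have "(\<integral>\<^sup>+z\<in>cell m x. ennreal (u z powr p) \<partial>\<omega>)
      \<le> (\<integral>\<^sup>+z. (\<Sum>t. ennreal ((real (Suc t) * K) powr p) * indicator (S t) z) \<partial>\<omega>)"
    using pt by (intro nn_integral_mono) simp
  also have "\<dots> = (\<Sum>t. ennreal ((real (Suc t) * K) powr p) * emeasure \<omega> (S t))"
    using S by (subst nn_integral_suminf) (simp_all add: nn_integral_cmult_indicator)
  also have "\<dots> \<le> (\<Sum>t. ennreal (A powr p * ((real (Suc t) * (2 + D)) powr p * (1/2)^t)) * emeasure \<omega> (cell m x))"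
  proof (intro suminf_le allI)
    fix t
    have "ennreal ((real (Suc t) * K) powr p) * emeasure \<omega> (S t)
      \<le> ennreal ((real (Suc t) * K) powr p) * (ennreal ((1/2)^t) * emeasure \<omega> (cell m x))"
      unfolding S_def u_def K_def by (intro mult_left_mono john_nirenberg_tail) auto
    also have "\<dots> = ennreal ((real (Suc t) * K) powr p * (1/2)^t) * emeasure \<omega> (cell m x)"
      unfolding mult.assoc[symmetric] by (subst ennreal_mult[symmetric]) auto
    also have "(real (Suc t) * K) powr p * (1/2)^t = A powr p * ((real (Suc t) * (2 + D)) powr p * (1/2)^t)"
      unfolding K_def using A D2 by (simp add: powr_mult)
    finally show "ennreal ((real (Suc t) * K) powr p) * emeasure \<omega> (S t)
      \<le> ennreal (A powr p * ((real (Suc t) * (2 + D)) powr p * (1/2)^t)) * emeasure \<omega> (cell m x)" .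
  qed auto
  also have "\<dots> = (\<Sum>t. ennreal (A powr p * ((real (Suc t) * (2 + D)) powr p * (1/2)^t))) * emeasure \<omega> (cell m x)"
    by (rule ennreal_suminf_multc)
  also have "(\<Sum>t. ennreal (A powr p * ((real (Suc t) * (2 + D)) powr p * (1/2)^t)))
      = ennreal (\<Sum>t. A powr p * ((real (Suc t) * (2 + D)) powr p * (1/2)^t))"
    by (intro suminf_ennreal2 summable_mult summable_john_nirenberg_const) auto
  also have "(\<Sum>t. A powr p * ((real (Suc t) * (2 + D)) powr p * (1/2)^t)) = A powr p * john_nirenberg_const D p"
    unfolding john_nirenberg_const_def by (intro suminf_mult summable_john_nirenberg_const)
  finally show ?thesis unfolding u_def .
qed

end

end

section \<open>Dyadic grids in Euclidean space\<close>

text \<open>Position of \<open>y\<close> in direction \<open>i\<close> in the grid of half-open cubes of side \<open>l / 2\<^bsup>n\<^esup>\<close> that has a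
  vertex at \<open>a\<close>.\<close>

definition grid_index :: "'a::euclidean_space \<Rightarrow> real \<Rightarrow> nat \<Rightarrow> 'a \<Rightarrow> 'a \<Rightarrow> int" where
  "grid_index a l n y i = \<lfloor>2 ^ n * ((y - a) \<bullet> i) / l\<rfloor>"

definition grid_cell :: "'a::euclidean_space \<Rightarrow> real \<Rightarrow> nat \<Rightarrow> 'a \<Rightarrow> 'a set" where
  "grid_cell a l n y = {z. \<forall>i\<in>Basis. grid_index a l n z i = grid_index a l n y i}"

lemma grid_cell_refl: "y \<in> grid_cell a l n y"
  unfolding grid_cell_def by simp

lemma grid_cell_eq: "z \<in> grid_cell a l n y \<Longrightarrow> grid_cell a l n z = grid_cell a l n y"
  unfolding grid_cell_def by auto

lemma grid_index_Suc: "grid_index a l n y i = grid_index a l (Suc n) y i div 2"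
proof -
  have "2 ^ n * ((y - a) \<bullet> i) / l = (2 ^ Suc n * ((y - a) \<bullet> i) / l) / real_of_int 2"
    by simp
  then show ?thesis
    unfolding grid_index_def by (simp only: floor_divide_real_eq_div)
qed

lemma grid_cell_Suc: "grid_cell a l (Suc n) y \<subseteq> grid_cell a l n y"
  unfolding grid_cell_def by (auto simp: grid_index_Suc[of a l n])

lemma grid_cell_borel: "grid_cell a l n y \<in> sets borel"
proof -
  have "{z \<in> space borel. \<forall>i\<in>Basis. grid_index a l n z i = grid_index a l n y i} \<in> sets borel"
    unfolding grid_index_def by measurable
  then show ?thesis unfolding grid_cell_def by simp
qed

text \<open>A cell is determined by its integer indices in the finitely many coordinate directions.\<close>

lemma grid_cell_countable: "countable (range (grid_cell a l n))"
proof -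
  define F where "F g = {z. \<forall>i\<in>Basis. grid_index a l n z i = g i}" for g
  have "grid_cell a l n y = F (restrict (grid_index a l n y) Basis)" for y
    unfolding grid_cell_def F_def by auto
  then have "range (grid_cell a l n) \<subseteq> F ` (Basis \<rightarrow>\<^sub>E UNIV)"
    by auto
  then show ?thesis
    by (rule countable_subset) (intro countable_image countable_PiE; simp)
qed

lemma grid_cell_subset_ball:
  fixes y :: "'a::euclidean_space"
  assumes l: "0 < l" and z: "z \<in> grid_cell a l n y"
  shows "grid_cell a l n y \<subseteq> ball z (real DIM('a) * l / 2 ^ n)"
proof
  fix w assume w: "w \<in> grid_cell a l n y"
  have "\<bar>(z - w) \<bullet> i\<bar> < l / 2 ^ n" if i: "i \<in> Basis" for i
  proof -
    have "\<lfloor>2 ^ n * ((z - a) \<bullet> i) / l\<rfloor> = \<lfloor>2 ^ n * ((w - a) \<bullet> i) / l\<rfloor>"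
      using z w i unfolding grid_cell_def grid_index_def by auto
    then have "\<bar>2 ^ n * ((z - a) \<bullet> i) / l - 2 ^ n * ((w - a) \<bullet> i) / l\<bar> < 1"
      by linarith
    also have "2 ^ n * ((z - a) \<bullet> i) / l - 2 ^ n * ((w - a) \<bullet> i) / l = 2 ^ n / l * ((z - w) \<bullet> i)"
      by (simp add: inner_diff_left algebra_simps diff_divide_distrib)
    finally show ?thesis
      using l by (simp add: abs_mult field_simps)
  qed
  then have "(\<Sum>i\<in>Basis. \<bar>(z - w) \<bullet> i\<bar>) < (\<Sum>i\<in>(Basis :: 'a set). l / 2 ^ n)"
    by (intro sum_strict_mono) auto
  then have "norm (z - w) < real DIM('a) * l / 2 ^ n"
    using norm_le_l1[of "z - w"] by simp
  then show "w \<in> ball z (real DIM('a) * l / 2 ^ n)"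
    by (simp add: dist_norm)
qed

lemma grid_cell_contains_ball:
  assumes l: "0 < l"
  shows "\<exists>c. ball c (l / 2 ^ n / 2) \<subseteq> grid_cell a l n y"
proof -
  \<comment> \<open>The midpoint of the cell.\<close>
  define c where "c = a + (\<Sum>i\<in>Basis. ((of_int (grid_index a l n y i) + 1/2) * (l / 2 ^ n)) *\<^sub>R i)"
  have "z \<in> grid_cell a l n y" if z: "z \<in> ball c (l / 2 ^ n / 2)" for z
    unfolding grid_cell_def
  proof (intro CollectI ballI)
    fix i :: 'a assume i: "i \<in> Basis"
    define d where "d = (z - c) \<bullet> i"
    define j where "j = grid_index a l n y i"
    have "\<bar>d\<bar> \<le> norm (z - c)" unfolding d_def using i by (rule Basis_le_norm)
    then have d: "\<bar>d\<bar> < l / 2 ^ n / 2" using z by (simp add: dist_norm norm_minus_commute)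
    have "(z - a) \<bullet> i = d + (of_int j + 1/2) * (l / 2 ^ n)"
      unfolding d_def j_def c_def using i by (simp add: inner_diff_left inner_add_left inner_sum_left_Basis)
    then have e: "2 ^ n * ((z - a) \<bullet> i) / l = of_int j + (1/2 + d * 2 ^ n / l)"
      using l by (simp add: field_simps)
    have "\<bar>d * 2 ^ n / l\<bar> < 1/2"
      using d l by (simp add: abs_mult field_simps)
    then have "\<lfloor>2 ^ n * ((z - a) \<bullet> i) / l\<rfloor> = j"
      unfolding e by (intro floor_unique) linarith+
    then show "grid_index a l n z i = grid_index a l n y i"
      unfolding grid_index_def[of a l n z] j_def .
  qed
  then show ?thesis by blast
qed

text \<open>Each ball lies in a single cell of level \<open>0\<close> of a grid adapted to it.\<close>

lemma ball_subset_grid_cell: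
  assumes r: "0 < r"
  shows "ball x r \<subseteq> grid_cell (x - r *\<^sub>R One) (2 * r) 0 x"
proof
  fix z assume z: "z \<in> ball x r"
  have "grid_index (x - r *\<^sub>R One) (2 * r) 0 w i = 0" if w: "w \<in> ball x r" and i: "i \<in> Basis" for w i
  proof -
    have "\<bar>(w - x) \<bullet> i\<bar> \<le> norm (w - x)" using i by (rule Basis_le_norm)
    then have "\<bar>(w - x) \<bullet> i\<bar> < r" using w by (simp add: dist_norm norm_minus_commute)
    moreover have "(w - (x - r *\<^sub>R One)) \<bullet> i = (w - x) \<bullet> i + r"
      using i by (simp add: inner_diff_left inner_add_left)
    ultimately show ?thesis
      unfolding grid_index_def using r by (intro floor_unique) (auto simp: field_simps)
  qed
  then show "z \<in> grid_cell (x - r *\<^sub>R One) (2 * r) 0 x"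
    unfolding grid_cell_def using z r by auto
qed

section \<open>Doubling measures\<close>

text \<open>The measure lives on the Lebesgue sigma-algebra. The growth condition is doubling in a
  quantitative form: it makes the exponent \<open>N\<close> visible, which has to be compared with the
  reverse Hoelder exponent later.\<close>

locale doubling_measure =
  fixes \<omega> :: "'a::euclidean_space measure" and \<kappa> N :: real
  assumes sets_eq: "sets \<omega> = sets lebesgue"
    and N_nonneg: "0 \<le> N"
    and ball_pos: "0 < r \<Longrightarrow> 0 < emeasure \<omega> (ball x r)"
    and ball_finite: "emeasure \<omega> (ball x r) < \<infinity>"
    and ball_growth: "0 < r \<Longrightarrow> r \<le> s \<Longrightarrow>
      measure \<omega> (ball x s) \<le> \<kappa> * (s / r) powr N * measure \<omega> (ball x r)"
    and outer_open: "F \<in> sets lebesgue \<Longrightarrow> bounded F \<Longrightarrow> 0 < e \<Longrightarrow>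
      \<exists>U. open U \<and> F \<subseteq> U \<and> emeasure \<omega> (U - F) \<le> ennreal e"
begin

lemma borel_in_sets: "B \<in> sets borel \<Longrightarrow> B \<in> sets \<omega>"
  using sets_eq by auto

lemma ball_sets: "ball x r \<in> sets \<omega>"
  by (simp add: borel_in_sets)

lemma measure_ball_pos: "0 < r \<Longrightarrow> 0 < measure \<omega> (ball x r)"
  using ball_pos[of r x] ball_finite[of x r] by (simp add: measure_def enn2real_positive_iff)

lemma emeasure_ball: "emeasure \<omega> (ball x r) = ennreal (measure \<omega> (ball x r))"
  using ball_finite[of x r] by (simp add: emeasure_eq_ennreal_measure)

lemma kappa_ge_1: "1 \<le> \<kappa>"
  using ball_growth[of 1 1 0] measure_ball_pos[of 1 0] by simp

lemma measure_subset_ball: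
  "A \<in> sets \<omega> \<Longrightarrow> A \<subseteq> ball x r \<Longrightarrow> measure \<omega> A \<le> measure \<omega> (ball x r)"
  using ball_finite[of x r] by (intro measure_mono_fmeasurable) (auto simp: fmeasurable_def ball_sets)

text \<open>Dominates the ratio of the measures of a cell, its parent, and a ball around it. The value is
  at least \<open>2\<close> so that \<open>(2 + D) A \<ge> 4A\<close> in the John-Nirenberg argument.\<close>

definition cell_const :: real where
  "cell_const = max 2 (\<kappa> * (4 * real DIM('a)) powr N)"

text \<open>The centre \<open>c\<close> is the midpoint of the cell. The ball on the left also contains the parent of
  the cell, so this single bound yields both the comparison of a cell with its parent and the
  comparison of oscillations on cells with those on balls.\<close>

lemma measure_ball_le_cell:
  assumes l: "0 < l"
  shows "\<exists>c\<in>grid_cell a l n y.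
    measure \<omega> (ball c (2 * (real DIM('a) * l / 2 ^ n))) \<le> cell_const * measure \<omega> (grid_cell a l n y)"
proof -
  let ?Q = "grid_cell a l n y" and ?r = "l / 2 ^ n / 2" and ?s = "2 * (real DIM('a) * l / 2 ^ n)"
  obtain c where c: "ball c ?r \<subseteq> ?Q"
    using grid_cell_contains_ball[OF l] by blast
  have r: "0 < ?r" using l by simp
  then have cQ: "c \<in> ?Q" using c by auto
  have Qs: "?Q \<in> sets \<omega>" by (intro borel_in_sets grid_cell_borel)
  have "?Q \<subseteq> ball c (real DIM('a) * l / 2 ^ n)"
    by (rule grid_cell_subset_ball[OF l cQ])
  then have "emeasure \<omega> ?Q \<le> emeasure \<omega> (ball c (real DIM('a) * l / 2 ^ n))"
    by (intro emeasure_mono ball_sets)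
  then have Qf: "?Q \<in> fmeasurable \<omega>"
    using Qs ball_finite[of c "real DIM('a) * l / 2 ^ n"] by (auto simp: fmeasurable_def)
  have ratio: "?s / ?r = 4 * real DIM('a)" using l by (simp add: field_simps)
  have "1 \<le> 4 * real DIM('a)" using DIM_positive[where 'a='a] by linarith
  then have rs: "?r \<le> ?s"
    using ratio r by (metis le_divide_eq_1_pos)
  have "measure \<omega> (ball c ?s) \<le> \<kappa> * (?s / ?r) powr N * measure \<omega> (ball c ?r)"
    by (rule ball_growth[OF r rs])
  also have "\<dots> \<le> cell_const * measure \<omega> (ball c ?r)"
    unfolding ratio cell_const_def by (intro mult_right_mono) auto
  also have "\<dots> \<le> cell_const * measure \<omega> ?Q"
    using c Qf ball_sets unfolding cell_const_def
    by (intro mult_left_mono measure_mono_fmeasurable) auto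
  finally show ?thesis using cQ by blast
qed

lemma grid_nested_cells:
  assumes l: "0 < l"
  shows "nested_cells \<omega> (grid_cell a l) cell_const"
proof
  fix n m :: nat and x y z :: 'a and F :: "'a set" and e :: real
  show "y \<in> grid_cell a l n y" by (rule grid_cell_refl)
  show "z \<in> grid_cell a l n y \<Longrightarrow> grid_cell a l n z = grid_cell a l n y" by (rule grid_cell_eq)
  show "grid_cell a l (Suc n) y \<subseteq> grid_cell a l n y" by (rule grid_cell_Suc)
  show cs: "grid_cell a l n y \<in> sets \<omega>" for n y by (intro borel_in_sets grid_cell_borel)
  show "countable (range (grid_cell a l n))" by (rule grid_cell_countable)
  have "emeasure \<omega> (grid_cell a l n y) \<le> emeasure \<omega> (ball y (real DIM('a) * l / 2 ^ n))"
    by (intro emeasure_mono ball_sets grid_cell_subset_ball[OF l] grid_cell_refl)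
  then show "emeasure \<omega> (grid_cell a l n y) < \<infinity>"
    using ball_finite by (rule order_le_less_trans)
  obtain c where c: "ball c (l / 2 ^ n / 2) \<subseteq> grid_cell a l n y"
    using grid_cell_contains_ball[OF l] by blast
  have "0 < emeasure \<omega> (ball c (l / 2 ^ n / 2))" using l by (intro ball_pos) simp
  also have "\<dots> \<le> emeasure \<omega> (grid_cell a l n y)" using c cs by (intro emeasure_mono)
  finally show "0 < emeasure \<omega> (grid_cell a l n y)" .
  show "measure \<omega> (grid_cell a l n y) \<le> cell_const * measure \<omega> (grid_cell a l (Suc n) y)"
  proof -
    obtain c where c: "c \<in> grid_cell a l (Suc n) y"
      "measure \<omega> (ball c (2 * (real DIM('a) * l / 2 ^ Suc n))) \<le> cell_const * measure \<omega> (grid_cell a l (Suc n) y)"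
      using measure_ball_le_cell[OF l] by blast
    have "grid_cell a l n y \<subseteq> ball c (real DIM('a) * l / 2 ^ n)"
      using c grid_cell_Suc[of a l n y] by (intro grid_cell_subset_ball[OF l]) auto
    then have "measure \<omega> (grid_cell a l n y) \<le> measure \<omega> (ball c (real DIM('a) * l / 2 ^ n))"
      using cs measure_subset_ball by blast
    then show ?thesis using c(2) by simp
  qed
  assume F: "F \<in> sets \<omega>" "F \<subseteq> grid_cell a l m x" and e: "0 < e"
  let ?Q = "grid_cell a l m x"
  have "bounded F"
    using F grid_cell_subset_ball[OF l grid_cell_refl, of a m x] bounded_ball bounded_subset by blast
  then obtain U where U: "open U" "F \<subseteq> U" "emeasure \<omega> (U - F) \<le> ennreal e"
    using outer_open[of F e] F e sets_eq by auto
  have Us: "U \<in> sets \<omega>" using U by (intro borel_in_sets) auto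
  have "emeasure \<omega> (U \<inter> ?Q - F) \<le> emeasure \<omega> (U - F)"
    using Us F by (intro emeasure_mono) auto
  then have le: "emeasure \<omega> (U \<inter> ?Q - F) \<le> ennreal e" using U by auto
  have small: "\<exists>n\<ge>m. grid_cell a l n y \<subseteq> U \<inter> ?Q" if y: "y \<in> U \<inter> ?Q" for y
  proof -
    obtain d where d: "0 < d" "ball y d \<subseteq> U"
      using U y open_contains_ball by blast
    have "(\<lambda>n. real DIM('a) * l / 2 ^ n) \<longlonglongrightarrow> 0"
      by real_asymp
    then have "\<forall>\<^sub>F n in sequentially. real DIM('a) * l / 2 ^ n < d \<and> m \<le> n"
      using d by (intro eventually_conj order_tendstoD eventually_ge_at_top) auto
    then obtain n where n: "real DIM('a) * l / 2 ^ n < d" "m \<le> n"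
      using eventually_happens' sequentially_bot by blast
    have "grid_cell a l n y \<subseteq> ball y (real DIM('a) * l / 2 ^ n)"
      by (rule grid_cell_subset_ball[OF l grid_cell_refl])
    also have "\<dots> \<subseteq> U" using n d by auto
    finally have "grid_cell a l n y \<subseteq> U" .
    moreover have "grid_cell a l n y \<subseteq> grid_cell a l m y"
      using n(2) by (induction n rule: dec_induct) (use grid_cell_Suc in blast)+
    ultimately show ?thesis using n y grid_cell_eq[of y a l m x] by auto
  qed
  show "\<exists>U\<in>sets \<omega>. F \<subseteq> U \<and> U \<subseteq> ?Q \<and> emeasure \<omega> (U - F) \<le> ennreal e
        \<and> (\<forall>y\<in>U. \<exists>n\<ge>m. grid_cell a l n y \<subseteq> U)"
    using U F Us cs le small by (intro bexI[of _ "U \<inter> ?Q"]) auto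
qed

lemma locally_integrable_ball:
  assumes "locally_integrable \<omega> f"
  shows "set_integrable \<omega> (ball x r) f"
proof -
  have "set_integrable \<omega> (cball x r) f"
    using assms compact_cball unfolding locally_integrable_def by blast
  then show ?thesis
    by (rule set_integrable_subset) (auto simp: ball_sets)
qed

text \<open>\<open>f\<close> is the pointwise limit of its restrictions to large balls.\<close>

lemma locally_integrable_measurable:
  assumes f: "locally_integrable \<omega> f"
  shows "f \<in> borel_measurable \<omega>"
proof (rule borel_measurable_LIMSEQ_metric)
  fix n :: nat
  show "(\<lambda>x. indicat_real (ball 0 (real n)) x *\<^sub>R f x) \<in> borel_measurable \<omega>"
    using locally_integrable_ball[OF f, of 0 "real n"] unfolding set_integrable_def by auto
next
  fix x :: 'a
  obtain k :: nat where k: "norm x < real k" using reals_Archimedean2 by blast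
  have "\<forall>\<^sub>F n in sequentially. indicat_real (ball 0 (real n)) x *\<^sub>R f x = f x"
    using eventually_ge_at_top[of k] by eventually_elim (use k in auto)
  then show "(\<lambda>n. indicat_real (ball 0 (real n)) x *\<^sub>R f x) \<longlonglongrightarrow> f x"
    by (rule tendsto_eventually)
qed

text \<open>Oscillations over cells are controlled by oscillations over balls of comparable measure, so the
  inequality for nested partitions applies to a cell that contains the given ball and has
  comparable measure. The centre is then moved from the mean over the cell to the mean over the
  ball.\<close>

lemma john_nirenberg_ball:
  assumes p: "1 \<le> p"
  shows "\<exists>M>0. \<forall>(f :: 'a \<Rightarrow> 'b::{banach,second_countable_topology}) C. locally_integrable \<omega> f \<longrightarrow> 0 < C \<longrightarrow>
    (\<forall>x r. 0 < r \<longrightarrow> mean \<omega> (ball x r) (\<lambda>y. norm (f y - mean \<omega> (ball x r) f)) \<le> C) \<longrightarrow>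
    (\<forall>x r. 0 < r \<longrightarrow> (\<integral>\<^sup>+y\<in>ball x r. ennreal (norm (f y - mean \<omega> (ball x r) f) powr p) \<partial>\<omega>)
       \<le> ennreal ((M * C) powr p) * emeasure \<omega> (ball x r))"
proof -
  define D where "D = cell_const"
  define J where "J = D + john_nirenberg_const D p powr (1/p)"
  define M where "M = 2 * D * (4 * J * D powr (1/p))"
  have D: "2 \<le> D" unfolding D_def cell_const_def by simp
  have J: "0 < J" unfolding J_def using D by (simp add: add_pos_nonneg)
  have M: "0 < M" unfolding M_def using D J by simp
  have bound: "(\<integral>\<^sup>+y\<in>ball x r. ennreal (norm (f y - mean \<omega> (ball x r) f) powr p) \<partial>\<omega>)
       \<le> ennreal ((M * C) powr p) * emeasure \<omega> (ball x r)"
    if f: "locally_integrable \<omega> f" and C: "0 < C" and r: "0 < r"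
      and osc: "\<And>x r. 0 < r \<Longrightarrow> mean \<omega> (ball x r) (\<lambda>y. norm (f y - mean \<omega> (ball x r) f)) \<le> C"
    for f :: "'a \<Rightarrow> 'b" and C r :: real and x :: 'a
  proof -
    define l where "l = 2 * r"
    define a where "a = x - r *\<^sub>R One"
    have l: "0 < l" unfolding l_def using r by simp
    interpret nested_cells \<omega> "grid_cell a l" D
      unfolding D_def by (rule grid_nested_cells[OF l])
    define A where "A = 2 * D * C"
    have A: "0 < A" unfolding A_def using C D by simp
    have fm: "f \<in> borel_measurable \<omega>" using f by (rule locally_integrable_measurable)
    have fi: "set_integrable \<omega> (grid_cell a l n y) f" for n y
      using grid_cell_subset_ball[OF l grid_cell_refl] cell_sets
      by (intro set_integrable_subset[OF locally_integrable_ball[OF f]])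
    have oscQ: "mean \<omega> (grid_cell a l n y) (\<lambda>z. norm (f z - mean \<omega> (grid_cell a l n y) f)) \<le> A" for n y
    proof -
      let ?Q = "grid_cell a l n y"
      obtain c where c: "c \<in> ?Q" "measure \<omega> (ball c (2 * (real DIM('a) * l / 2 ^ n))) \<le> D * measure \<omega> ?Q"
        unfolding D_def using measure_ball_le_cell[OF l] by blast
      define s where "s = 2 * (real DIM('a) * l / 2 ^ n)"
      have s0: "0 < real DIM('a) * l / 2 ^ n" using l DIM_positive[where 'a='a] by simp
      have s: "0 < s" unfolding s_def using s0 by linarith
      have "?Q \<subseteq> ball c (real DIM('a) * l / 2 ^ n)" by (rule grid_cell_subset_ball[OF l c(1)])
      also have "\<dots> \<subseteq> ball c s"
        unfolding s_def by (rule subset_ball, rule mult_le_cancel_right1[THEN iffD2]) (use s0 in auto)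
      finally have Qs: "?Q \<subseteq> ball c s" .
      let ?b = "mean \<omega> (ball c s) f"
      have "mean \<omega> ?Q (\<lambda>z. norm (f z - mean \<omega> ?Q f)) \<le> 2 * mean \<omega> ?Q (\<lambda>z. norm (f z - ?b))"
        by (intro mean_oscillation_le fi cell_sets cell_finite cell_pos)
      also have "mean \<omega> ?Q (\<lambda>z. norm (f z - ?b)) \<le> D * mean \<omega> (ball c s) (\<lambda>z. norm (f z - ?b))"
        using c(2) unfolding s_def[symmetric]
        by (intro mean_norm_mono_set set_integrable_diff_const locally_integrable_ball f Qs ball_sets
              ball_finite cell_sets measure_cell_pos measure_ball_pos s)
      also have "\<dots> \<le> D * C" using osc[OF s] D by (intro mult_left_mono) auto
      finally show ?thesis unfolding A_def by simp
    qed
    define Q where "Q = grid_cell a l 0 x"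
    define B where "B = ball x r"
    have BQ: "B \<subseteq> Q" unfolding B_def Q_def a_def l_def by (rule ball_subset_grid_cell[OF r])
    have Qm: "measure \<omega> Q \<le> D * measure \<omega> B"
    proof -
      have "1 \<le> real DIM('a)" using DIM_positive[where 'a='a] by linarith
      then have "1 \<le> real DIM('a) * 2" by linarith
      then have rl: "r \<le> real DIM('a) * l" and rl': "real DIM('a) * l / r \<le> 4 * real DIM('a)"
        unfolding l_def using r by (auto simp: field_simps)
      have "Q \<subseteq> ball x (real DIM('a) * l)"
        unfolding Q_def using grid_cell_subset_ball[OF l grid_cell_refl, of a 0 x] by simp
      then have "measure \<omega> Q \<le> measure \<omega> (ball x (real DIM('a) * l))"
        unfolding Q_def by (intro measure_subset_ball cell_sets)
      also have "\<dots> \<le> \<kappa> * (real DIM('a) * l / r) powr N * measure \<omega> B"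
        unfolding B_def by (rule ball_growth[OF r rl])
      also have "\<dots> \<le> \<kappa> * (4 * real DIM('a)) powr N * measure \<omega> B"
        using rl' r l N_nonneg kappa_ge_1 by (intro mult_right_mono mult_left_mono powr_mono2) auto
      also have "\<dots> \<le> D * measure \<omega> B"
        unfolding D_def cell_const_def by (intro mult_right_mono) auto
      finally show ?thesis .
    qed
    let ?q = "mean \<omega> Q f" and ?b = "mean \<omega> B f"
    have "norm (?b - ?q) \<le> mean \<omega> B (\<lambda>y. norm (f y - ?q))"
      unfolding B_def by (intro norm_mean_diff_le locally_integrable_ball f ball_sets ball_finite ball_pos r)
    also have "\<dots> \<le> D * mean \<omega> Q (\<lambda>y. norm (f y - ?q))"
      using BQ Qm unfolding B_def Q_def
      by (intro mean_norm_mono_set set_integrable_diff_const fi ball_sets cell_sets cell_finite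
            measure_cell_pos measure_ball_pos r)
    also have "\<dots> \<le> D * A"
      using oscQ D unfolding Q_def by (intro mult_left_mono) auto
    finally have bq: "norm (?b - ?q) \<le> D * A" .
    have Qsets: "Q \<in> sets \<omega>" unfolding Q_def by (rule cell_sets)
    have "(\<integral>\<^sup>+y\<in>Q. ennreal (norm (f y - ?q) powr p) \<partial>\<omega>) \<le> ennreal (A powr p * john_nirenberg_const D p) * emeasure \<omega> Q"
      unfolding Q_def by (intro john_nirenberg_Lp fm fi A D oscQ p)
    also have "\<dots> \<le> ennreal ((A * J) powr p) * emeasure \<omega> Q"
    proof (intro mult_right_mono ennreal_leI)
      have "john_nirenberg_const D p = (john_nirenberg_const D p powr (1/p)) powr p"
        using p john_nirenberg_const_nonneg[of D p] by (simp add: powr_powr)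
      also have "\<dots> \<le> J powr p"
        unfolding J_def using p D by (intro powr_mono2) auto
      finally show "A powr p * john_nirenberg_const D p \<le> (A * J) powr p"
        using A J by (simp add: powr_mult)
    qed simp
    finally have q: "(\<integral>\<^sup>+y\<in>Q. ennreal (norm (f y - ?q) powr p) \<partial>\<omega>) \<le> ennreal ((A * J) powr p) * emeasure \<omega> Q" .
    have "D * A \<le> A * J" unfolding J_def using A by (simp add: algebra_simps)
    then have qb: "norm (?q - ?b) \<le> A * J" using bq by (simp add: norm_minus_commute)
    have "(\<integral>\<^sup>+y\<in>B. ennreal (norm (f y - ?b) powr p) \<partial>\<omega>) \<le> (\<integral>\<^sup>+y\<in>Q. ennreal (norm (f y - ?b) powr p) \<partial>\<omega>)"
      using BQ by (intro nn_integral_mono) (auto simp: indicator_def)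
    also have "\<dots> \<le> ennreal ((4 * (A * J)) powr p) * emeasure \<omega> Q"
      using A J by (intro set_nn_integral_powr_shift[OF Qsets fi[of 0 x, folded Q_def] p _ q qb]) simp
    also have "\<dots> = ennreal ((4 * (A * J)) powr p * measure \<omega> Q)"
      using cell_finite[of 0 x] unfolding Q_def by (simp add: emeasure_eq_ennreal_measure ennreal_mult)
    also have "\<dots> \<le> ennreal ((4 * (A * J)) powr p * (D * measure \<omega> B))"
      using Qm by (intro ennreal_leI mult_left_mono) auto
    also have "(4 * (A * J)) powr p * (D * measure \<omega> B) = (M * C) powr p * measure \<omega> B"
    proof -
      have "M * C = 4 * (A * J) * D powr (1/p)" unfolding M_def A_def by simp
      then have "(M * C) powr p = (4 * (A * J)) powr p * D"
        using J A D p by (simp add: powr_mult powr_powr)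
      then show ?thesis by simp
    qed
    also have "ennreal ((M * C) powr p * measure \<omega> B) = ennreal ((M * C) powr p) * emeasure \<omega> B"
      unfolding B_def emeasure_ball by (simp add: ennreal_mult)
    finally show ?thesis unfolding B_def .
  qed
  show ?thesis
    using M bound by blast
qed

end

section \<open>BMO for a doubling measure and a positive radius function\<close>

context doubling_measure
begin

text \<open>Beyond the critical radius an oscillation is at most twice the mean of the norm.\<close>

lemma BMO_bound_oscillation:
  fixes f :: "'a \<Rightarrow> 'b::{banach,second_countable_topology}"
  assumes f: "locally_integrable \<omega> f" and C: "BMO_bound \<omega> \<rho> f C" and r: "0 < r"
  shows "mean \<omega> (ball x r) (\<lambda>y. norm (f y - mean \<omega> (ball x r) f)) \<le> 2 * C"
proof (cases "r < \<rho> x")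
  case True
  then have "mean \<omega> (ball x r) (\<lambda>y. norm (f y - mean \<omega> (ball x r) f)) \<le> C" and "0 \<le> C"
    using C r unfolding BMO_bound_def by blast+
  then show ?thesis by simp
next
  case False
  then have "mean \<omega> (ball x r) (\<lambda>y. norm (f y)) \<le> C"
    using C r unfolding BMO_bound_def by auto
  then show ?thesis
    using mean_oscillation_le[OF locally_integrable_ball[OF f] ball_sets ball_finite ball_pos[OF r], of x 0]
    by simp
qed

lemma mean_telescope:
  fixes f :: "'a \<Rightarrow> 'b::{banach,second_countable_topology}"
  assumes f: "locally_integrable \<omega> f" and r: "0 < r"
    and osc: "\<And>s. 0 < s \<Longrightarrow> mean \<omega> (ball x s) (\<lambda>y. norm (f y - mean \<omega> (ball x s) f)) \<le> A"
  shows "norm (mean \<omega> (ball x r) f) \<le> real j * (\<kappa> * 2 powr N * A) + norm (mean \<omega> (ball x (2 ^ j * r)) f)"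
proof (induction j)
  case (Suc j)
  let ?s = "2 ^ j * r"
  let ?b = "mean \<omega> (ball x (2 * ?s)) f"
  have s: "0 < ?s" "0 < 2 * ?s" "?s \<le> 2 * ?s" using r by auto
  have gr: "measure \<omega> (ball x (2 * ?s)) \<le> \<kappa> * 2 powr N * measure \<omega> (ball x ?s)"
    using ball_growth[OF s(1) s(3), of x] r by simp
  have "norm (mean \<omega> (ball x ?s) f - ?b) \<le> mean \<omega> (ball x ?s) (\<lambda>y. norm (f y - ?b))"
    by (intro norm_mean_diff_le locally_integrable_ball f ball_sets ball_finite ball_pos s)
  also have "\<dots> \<le> \<kappa> * 2 powr N * mean \<omega> (ball x (2 * ?s)) (\<lambda>y. norm (f y - ?b))"
    using gr by (intro mean_norm_mono_set set_integrable_diff_const locally_integrable_ball f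
        subset_ball ball_sets ball_finite measure_ball_pos s)
  also have "\<dots> \<le> \<kappa> * 2 powr N * A"
    using osc[OF s(2)] kappa_ge_1 by (intro mult_left_mono) auto
  finally have "norm (mean \<omega> (ball x ?s) f) \<le> \<kappa> * 2 powr N * A + norm ?b"
    using norm_triangle_ineq2[of "mean \<omega> (ball x ?s) f" ?b] by linarith
  then show ?case using Suc.IH by (simp add: algebra_simps)
qed simp

text \<open>With \<open>j = \<lceil>log\<^sub>2 (\<rho> x / r)\<rceil>\<close> doublings the radius reaches \<open>\<rho> x\<close>, where the mean is at most
  \<open>C\<close>. As \<open>r < \<rho> x\<close>, the logarithm \<open>log\<^sub>2 (1 + \<rho> x / r)\<close> is at least \<open>1\<close>; it therefore absorbs
  the rounding in \<open>j\<close> and the additive constant.\<close>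

lemma mean_le_log:
  fixes f :: "'a \<Rightarrow> 'b::{banach,second_countable_topology}"
  assumes f: "locally_integrable \<omega> f" and C: "BMO_bound \<omega> \<rho> f C" and r: "0 < r" "r < \<rho> x"
  shows "norm (mean \<omega> (ball x r) f) \<le> (4 * \<kappa> * 2 powr N + 1) * C * log 2 (1 + \<rho> x / r)"
proof -
  define H where "H = \<kappa> * 2 powr N"
  define L where "L = log 2 (1 + \<rho> x / r)"
  define j where "j = nat \<lceil>log 2 (\<rho> x / r)\<rceil>"
  have C0: "0 \<le> C" using C unfolding BMO_bound_def by auto
  have H: "0 \<le> H" unfolding H_def using kappa_ge_1 by simp
  have q: "1 < \<rho> x / r" using r by simp
  then have l0: "0 < log 2 (\<rho> x / r)" by simp
  have "log 2 2 \<le> L" unfolding L_def using q by (intro log_le_cancel_iff[THEN iffD2]) auto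
  then have L1: "1 \<le> L" by simp
  have Ll: "log 2 (\<rho> x / r) \<le> L" unfolding L_def using q by (intro log_le_cancel_iff[THEN iffD2]) auto
  have "real j \<le> log 2 (\<rho> x / r) + 1" "log 2 (\<rho> x / r) \<le> real j"
    unfolding j_def using l0 by linarith+
  then have jL: "real j \<le> 2 * L" and "\<rho> x / r \<le> 2 powr real j"
    using L1 Ll q by (linarith, simp add: log_le_iff)
  then have rj: "\<rho> x \<le> 2 ^ j * r" using r by (simp add: powr_realpow field_simps)
  have rj0: "0 < 2 ^ j * r" using r by simp
  have "norm (mean \<omega> (ball x (2 ^ j * r)) f) \<le> mean \<omega> (ball x (2 ^ j * r)) (\<lambda>y. norm (f y))"
    by (intro norm_mean_le locally_integrable_ball f)
  also have "\<dots> \<le> C" using C rj rj0 unfolding BMO_bound_def by blast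
  finally have "norm (mean \<omega> (ball x r) f) \<le> real j * (H * (2 * C)) + C"
    using mean_telescope[OF f r(1) BMO_bound_oscillation[OF f C], of x j] unfolding H_def by simp
  also have "\<dots> \<le> (2 * L) * (H * (2 * C)) + C * L"
    using jL H C0 L1 mult_left_mono[of 1 L C] by (intro add_mono mult_right_mono) auto
  also have "\<dots> = (4 * H + 1) * C * L" by (simp add: algebra_simps)
  finally show ?thesis unfolding L_def H_def by (simp add: mult.assoc)
qed

text \<open>The family of constants that realizes the norm of \<open>BMO\<close> up to a factor.\<close>

definition truncated_means :: "('a \<Rightarrow> real) \<Rightarrow> ('a \<Rightarrow> 'b::{banach,second_countable_topology}) \<Rightarrow> 'a \<Rightarrow> real \<Rightarrow> 'b" where
  "truncated_means \<rho> f x r = (if r < \<rho> x then mean \<omega> (ball x r) f else 0)"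

lemma truncated_means_admissible:
  assumes p: "1 \<le> p"
  shows "\<exists>M>0. \<forall>(f :: 'a \<Rightarrow> 'b::{banach,second_countable_topology}) C. locally_integrable \<omega> f \<longrightarrow> 0 < C \<longrightarrow>
    BMO_bound \<omega> \<rho> f C \<longrightarrow>
      osc_const \<omega> p f (truncated_means \<rho> f) \<le> ennreal (M * C) \<and>
      log_const \<rho> (truncated_means \<rho> f) \<le> ennreal (M * C)"
proof -
  obtain J where J: "0 < J" and JN: "\<forall>(f :: 'a \<Rightarrow> 'b) C. locally_integrable \<omega> f \<longrightarrow> 0 < C \<longrightarrow>
    (\<forall>x r. 0 < r \<longrightarrow> mean \<omega> (ball x r) (\<lambda>y. norm (f y - mean \<omega> (ball x r) f)) \<le> C) \<longrightarrow>
    (\<forall>x r. 0 < r \<longrightarrow> (\<integral>\<^sup>+y\<in>ball x r. ennreal (norm (f y - mean \<omega> (ball x r) f) powr p) \<partial>\<omega>)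
       \<le> ennreal ((J * C) powr p) * emeasure \<omega> (ball x r))"
    using john_nirenberg_ball[OF p, where 'b='b] by (elim exE conjE) (rule that)
  define M where "M = max (8 * (J + 1)) (4 * \<kappa> * 2 powr N + 1)"
  have M: "0 < M" unfolding M_def using J by simp
  have "osc_const \<omega> p f (truncated_means \<rho> f) \<le> ennreal (M * C) \<and>
      log_const \<rho> (truncated_means \<rho> f) \<le> ennreal (M * C)"
    if f: "locally_integrable \<omega> f" and C: "0 < C" and bmo: "BMO_bound \<omega> \<rho> f C" for f :: "'a \<Rightarrow> 'b" and C
  proof
    let ?c = "truncated_means \<rho> f"
    show "osc_const \<omega> p f ?c \<le> ennreal (M * C)"
      unfolding osc_const_def
    proof (intro SUP_least)
      fix x r assume "r \<in> {0::real<..}"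
      then have r: "0 < r" by simp
      let ?b = "mean \<omega> (ball x r) f"
      let ?L = "(J + 1) * (2 * C)"
      have L: "0 \<le> ?L" using J C by simp
      have "(\<integral>\<^sup>+y\<in>ball x r. ennreal (norm (f y - ?b) powr p) \<partial>\<omega>)
        \<le> ennreal ((J * (2 * C)) powr p) * emeasure \<omega> (ball x r)"
        using C BMO_bound_oscillation[OF f bmo]
        by (intro JN[rule_format, OF f _ _ r]) auto
      also have "\<dots> \<le> ennreal (?L powr p) * emeasure \<omega> (ball x r)"
        using p J C by (intro mult_right_mono ennreal_leI powr_mono2) auto
      finally have le: "(\<integral>\<^sup>+y\<in>ball x r. ennreal (norm (f y - ?b) powr p) \<partial>\<omega>)
        \<le> ennreal (?L powr p) * emeasure \<omega> (ball x r)" .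
      have bc: "norm (?b - ?c x r) \<le> ?L"
      proof (cases "r < \<rho> x")
        case False
        have "norm ?b \<le> mean \<omega> (ball x r) (\<lambda>y. norm (f y))"
          by (intro norm_mean_le locally_integrable_ball f)
        also have "\<dots> \<le> C" using bmo False r unfolding BMO_bound_def by auto
        also have "\<dots> \<le> ?L" using J C by (simp add: algebra_simps)
        finally show ?thesis using False by (simp add: truncated_means_def)
      qed (use L in \<open>simp add: truncated_means_def\<close>)
      have "(\<integral>\<^sup>+y\<in>ball x r. ennreal (norm (f y - ?c x r) powr p) \<partial>\<omega>)
        \<le> ennreal ((4 * ?L) powr p) * emeasure \<omega> (ball x r)"
        by (rule set_nn_integral_powr_shift[OF ball_sets locally_integrable_ball[OF f] p L le bc])
      then have "Lp_mean \<omega> p (ball x r) (\<lambda>y. f y - ?c x r) \<le> ennreal (4 * ?L)"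
        using L by (subst Lp_mean_le_iff[OF ball_finite ball_pos[OF r] p]) auto
      also have "\<dots> \<le> ennreal (M * C)"
        using C mult_right_mono[of "8 * (J + 1)" M C] unfolding M_def
        by (intro ennreal_leI) (simp add: algebra_simps)
      finally show "Lp_mean \<omega> p (ball x r) (\<lambda>y. f y - ?c x r) \<le> ennreal (M * C)" .
    qed
    show "log_const \<rho> ?c \<le> ennreal (M * C)"
      unfolding log_const_def
    proof (intro SUP_least ennreal_leI)
      fix x r assume "r \<in> {0::real<..}"
      then have r: "0 < r" by simp
      show "norm (?c x r) / log 2 (1 + \<rho> x / r) \<le> M * C"
      proof (cases "r < \<rho> x")
        case True
        then have "0 < \<rho> x / r" using r by simp
        then have l: "0 < log 2 (1 + \<rho> x / r)" by simp
        have "norm (?c x r) \<le> (4 * \<kappa> * 2 powr N + 1) * C * log 2 (1 + \<rho> x / r)"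
          using mean_le_log[OF f bmo r True] True by (simp add: truncated_means_def)
        also have "\<dots> \<le> M * C * log 2 (1 + \<rho> x / r)"
          using C l unfolding M_def by (intro mult_right_mono) auto
        finally show ?thesis using l by (simp add: divide_le_eq)
      qed (use M C in \<open>simp add: truncated_means_def\<close>)
    qed
  qed
  then show ?thesis using M by blast
qed

text \<open>Positivity of \<open>\<rho>\<close> enters through the logarithm: for \<open>r \<ge> \<rho> x\<close> it lies in \<open>(0, 1]\<close>, so that the
  quotient bounds the constant itself.\<close>

lemma BMO_bound_of_family:
  fixes f :: "'a \<Rightarrow> 'b::{banach,second_countable_topology}"
  assumes rho: "\<And>x. 0 < \<rho> x" and p: "1 \<le> p" and f: "locally_integrable \<omega> f" and L: "0 < L"
    and osc: "osc_const \<omega> p f c \<le> ennreal L" and lg: "log_const \<rho> c \<le> ennreal L"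
  shows "BMO_bound \<omega> \<rho> f (4 * L)"
proof -
  have m: "mean \<omega> (ball x r) (\<lambda>y. norm (f y - c x r)) \<le> 2 * L" if r: "0 < r" for x r
  proof -
    have "Lp_mean \<omega> p (ball x r) (\<lambda>y. f y - c x r) \<le> osc_const \<omega> p f c"
      unfolding osc_const_def using r by (intro SUP_upper2[of x] SUP_upper2[of r]) auto
    then have "Lp_mean \<omega> p (ball x r) (\<lambda>y. f y - c x r) \<le> ennreal L"
      using osc by simp
    then have "(\<integral>\<^sup>+y\<in>ball x r. ennreal (norm (f y - c x r) powr p) \<partial>\<omega>) \<le> ennreal (L powr p) * emeasure \<omega> (ball x r)"
      using L by (subst (asm) Lp_mean_le_iff[OF ball_finite ball_pos[OF r] p]) auto
    then show ?thesis
      by (intro mean_le_of_powr[OF ball_sets _ p less_imp_le[OF L] ball_finite ball_pos[OF r]]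
          set_integrable_diff_const locally_integrable_ball f ball_sets ball_finite)
  qed
  show ?thesis
    unfolding BMO_bound_def
  proof (intro conjI allI impI)
    show "0 \<le> 4 * L" using L by simp
    fix x r assume "0 < r \<and> r < \<rho> x"
    then have r: "0 < r" by simp
    show "mean \<omega> (ball x r) (\<lambda>y. norm (f y - mean \<omega> (ball x r) f)) \<le> 4 * L"
      using mean_oscillation_le[OF locally_integrable_ball[OF f] ball_sets ball_finite ball_pos[OF r], of x "c x r"]
        m[OF r, of x] by simp
  next
    fix x r assume "0 < r \<and> \<rho> x \<le> r"
    then have r: "0 < r" and big: "\<rho> x \<le> r" by auto
    define l where "l = log 2 (1 + \<rho> x / r)"
    have "log 2 (1 + \<rho> x / r) \<le> log 2 2"
      using rho[of x] r big by (intro log_le_cancel_iff[THEN iffD2]) (auto intro: add_pos_pos)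
    moreover have "0 < \<rho> x / r" using rho[of x] r by simp
    ultimately have l: "0 < l" "l \<le> 1"
      unfolding l_def by simp_all
    have "ennreal (norm (c x r) / l) \<le> log_const \<rho> c"
      unfolding log_const_def l_def using r by (intro SUP_upper2[of x] SUP_upper2[of r]) auto
    then have "ennreal (norm (c x r) / l) \<le> ennreal L" using lg by simp
    then have "norm (c x r) \<le> L * l" using L l by (simp add: ennreal_le_iff field_simps)
    also have "\<dots> \<le> L" using L l mult_left_mono[of l 1 L] by simp
    finally have c: "norm (c x r) \<le> L" .
    have "mean \<omega> (ball x r) (\<lambda>y. norm (f y - 0)) \<le> mean \<omega> (ball x r) (\<lambda>y. norm (f y - c x r)) + norm (c x r - 0)"
      by (intro mean_triangle locally_integrable_ball f ball_sets ball_finite ball_pos r)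
    then show "mean \<omega> (ball x r) (\<lambda>y. norm (f y)) \<le> 4 * L"
      using m[OF r, of x] c L by simp
  qed
qed

lemma BMO_norm_nonneg: "f \<in> BMO_space \<omega> \<rho> \<Longrightarrow> 0 \<le> BMO_norm \<omega> \<rho> f"
  unfolding BMO_norm_def by (intro cInf_greatest) (auto simp: BMO_space_def BMO_bound_def)

lemma BMO_norm_le: "BMO_bound \<omega> \<rho> f C \<Longrightarrow> BMO_norm \<omega> \<rho> f \<le> C"
  unfolding BMO_norm_def by (intro cInf_lower bdd_belowI[of _ 0]) (auto simp: BMO_bound_def)

lemma BMO_bound_of_norm_less:
  assumes f: "f \<in> BMO_space \<omega> \<rho>" and C: "BMO_norm \<omega> \<rho> f < C"
  shows "BMO_bound \<omega> \<rho> f C"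
proof -
  have "{C. BMO_bound \<omega> \<rho> f C} \<noteq> {}" using f unfolding BMO_space_def by auto
  then obtain C' where "BMO_bound \<omega> \<rho> f C'" "C' < C"
    using cInf_lessD[of "{C. BMO_bound \<omega> \<rho> f C}" C] C unfolding BMO_norm_def by auto
  then show ?thesis unfolding BMO_bound_def by (meson less_imp_le order_trans)
qed

text \<open>Both infima, the one in the norm and the one over families, are treated by approximation: every
  constant above the norm is a bound for \<open>f\<close> and yields a family, and every finite constant above
  the value of a family yields a bound.\<close>

theorem BMO_characterization:
  assumes rho: "\<And>x. 0 < \<rho> x" and p: "1 \<le> p"
  shows "(\<forall>f :: 'a \<Rightarrow> 'b::{banach,second_countable_topology}. locally_integrable \<omega> f \<longrightarrow>
      (f \<in> BMO_space \<omega> \<rho> \<longleftrightarrow> (\<exists>c. osc_const \<omega> p f c < \<infinity> \<and> log_const \<rho> c < \<infinity>))) \<and>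
    (\<exists>A>0. \<exists>A'>0. \<forall>f :: 'a \<Rightarrow> 'b. f \<in> BMO_space \<omega> \<rho> \<longrightarrow>
      ennreal (BMO_norm \<omega> \<rho> f) \<le>
        ennreal A * (INF c\<in>admissible_families \<omega> \<rho> p f. max (osc_const \<omega> p f c) (log_const \<rho> c)) \<and>
      (INF c\<in>admissible_families \<omega> \<rho> p f. max (osc_const \<omega> p f c) (log_const \<rho> c)) \<le>
        ennreal A' * ennreal (BMO_norm \<omega> \<rho> f))"
proof -
  obtain M where M: "0 < M" and adm: "\<forall>(f :: 'a \<Rightarrow> 'b) C. locally_integrable \<omega> f \<longrightarrow> 0 < C \<longrightarrow>
    BMO_bound \<omega> \<rho> f C \<longrightarrow>
      osc_const \<omega> p f (truncated_means \<rho> f) \<le> ennreal (M * C) \<and>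
      log_const \<rho> (truncated_means \<rho> f) \<le> ennreal (M * C)"
    using truncated_means_admissible[OF p, of \<rho>, where 'b='b] by (elim exE conjE) (rule that)
  have norm_bound: "ennreal (BMO_norm \<omega> \<rho> f) \<le> ennreal 4 * max (osc_const \<omega> p f c) (log_const \<rho> c)"
    and space: "f \<in> BMO_space \<omega> \<rho>"
    if f: "locally_integrable \<omega> f" and c: "osc_const \<omega> p f c < \<infinity>" "log_const \<rho> c < \<infinity>" for f :: "'a \<Rightarrow> 'b" and c
  proof -
    define m where "m = max (osc_const \<omega> p f c) (log_const \<rho> c)"
    have "m < \<infinity>" unfolding m_def using c by simp
    then obtain L where L: "m = ennreal L" "0 \<le> L"
      by (cases m) auto
    have bmo: "BMO_bound \<omega> \<rho> f (4 * (L + e))" if e: "0 < e" for e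
    proof (rule BMO_bound_of_family[OF rho p f, of "L + e" c])
      have "m \<le> ennreal (L + e)" unfolding L using e by (intro ennreal_leI) simp
      then show "osc_const \<omega> p f c \<le> ennreal (L + e)" "log_const \<rho> c \<le> ennreal (L + e)"
        unfolding m_def by auto
    qed (use L e in simp)
    then show "f \<in> BMO_space \<omega> \<rho>"
      using f bmo[of 1] unfolding BMO_space_def by auto
    have "BMO_norm \<omega> \<rho> f \<le> 4 * L"
    proof (rule field_le_epsilon)
      fix e :: real assume "0 < e"
      then show "BMO_norm \<omega> \<rho> f \<le> 4 * L + e"
        using BMO_norm_le[OF bmo[of "e/4"]] by simp
    qed
    then have "ennreal (BMO_norm \<omega> \<rho> f) \<le> ennreal (4 * L)" by (rule ennreal_leI)
    also have "\<dots> = ennreal 4 * m" unfolding L by (rule ennreal_mult) (use L in auto)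
    finally show "ennreal (BMO_norm \<omega> \<rho> f) \<le> ennreal 4 * max (osc_const \<omega> p f c) (log_const \<rho> c)"
      unfolding m_def .
  qed
  have family: "truncated_means \<rho> f \<in> admissible_families \<omega> \<rho> p f"
    and family_le: "max (osc_const \<omega> p f (truncated_means \<rho> f)) (log_const \<rho> (truncated_means \<rho> f)) \<le> ennreal (M * C)"
    if f: "f \<in> BMO_space \<omega> \<rho>" and C: "BMO_norm \<omega> \<rho> f < C" for f :: "'a \<Rightarrow> 'b" and C
  proof -
    have fl: "locally_integrable \<omega> f" using f unfolding BMO_space_def by auto
    have "0 < C" using BMO_norm_nonneg[OF f] C by simp
    then have *: "osc_const \<omega> p f (truncated_means \<rho> f) \<le> ennreal (M * C)"
      "log_const \<rho> (truncated_means \<rho> f) \<le> ennreal (M * C)"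
      using adm[rule_format, OF fl _ BMO_bound_of_norm_less[OF f C]] by auto
    then show "max (osc_const \<omega> p f (truncated_means \<rho> f)) (log_const \<rho> (truncated_means \<rho> f)) \<le> ennreal (M * C)"
      by simp
    show "truncated_means \<rho> f \<in> admissible_families \<omega> \<rho> p f"
      unfolding admissible_families_def using * by (auto intro: order_le_less_trans)
  qed
  show ?thesis
  proof (intro conjI allI impI)
    fix f :: "'a \<Rightarrow> 'b" assume f: "locally_integrable \<omega> f"
    show "f \<in> BMO_space \<omega> \<rho> \<longleftrightarrow> (\<exists>c. osc_const \<omega> p f c < \<infinity> \<and> log_const \<rho> c < \<infinity>)"
    proof
      assume "f \<in> BMO_space \<omega> \<rho>"
      then have "truncated_means \<rho> f \<in> admissible_families \<omega> \<rho> p f"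
        using family[of f "BMO_norm \<omega> \<rho> f + 1"] by simp
      then show "\<exists>c. osc_const \<omega> p f c < \<infinity> \<and> log_const \<rho> c < \<infinity>"
        unfolding admissible_families_def by blast
    qed (use space f in blast)
  next
    have "ennreal (BMO_norm \<omega> \<rho> f) \<le>
        ennreal 4 * (INF c\<in>admissible_families \<omega> \<rho> p f. max (osc_const \<omega> p f c) (log_const \<rho> c)) \<and>
      (INF c\<in>admissible_families \<omega> \<rho> p f. max (osc_const \<omega> p f c) (log_const \<rho> c)) \<le>
        ennreal M * ennreal (BMO_norm \<omega> \<rho> f)" if f: "f \<in> BMO_space \<omega> \<rho>" for f :: "'a \<Rightarrow> 'b"
    proof
      from f have fl: "locally_integrable \<omega> f" unfolding BMO_space_def by auto
      let ?I = "INF c\<in>admissible_families \<omega> \<rho> p f. max (osc_const \<omega> p f c) (log_const \<rho> c)"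
      have "ennreal (BMO_norm \<omega> \<rho> f) / ennreal 4 \<le> ?I"
      proof (rule INF_greatest)
        fix c assume "c \<in> admissible_families \<omega> \<rho> p f"
        then have "ennreal (BMO_norm \<omega> \<rho> f) \<le> ennreal 4 * max (osc_const \<omega> p f c) (log_const \<rho> c)"
          using norm_bound[OF fl] unfolding admissible_families_def by auto
        then show "ennreal (BMO_norm \<omega> \<rho> f) / ennreal 4 \<le> max (osc_const \<omega> p f c) (log_const \<rho> c)"
          by (intro divide_le_posI_ennreal) (auto simp: mult.commute)
      qed
      then have "ennreal 4 * (ennreal (BMO_norm \<omega> \<rho> f) / ennreal 4) \<le> ennreal 4 * ?I"
        by (intro mult_left_mono) auto
      then show "ennreal (BMO_norm \<omega> \<rho> f) \<le> ennreal 4 * ?I"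
        using BMO_norm_nonneg[OF f] by (simp add: divide_ennreal ennreal_mult[symmetric] del: ennreal_numeral)
      show "?I \<le> ennreal M * ennreal (BMO_norm \<omega> \<rho> f)"
      proof (rule ennreal_le_epsilon)
        fix e :: real assume e: "0 < e"
        let ?C = "BMO_norm \<omega> \<rho> f + e / M"
        have "BMO_norm \<omega> \<rho> f < ?C" using e M by simp
        then have "?I \<le> ennreal (M * ?C)"
          using family[OF f] family_le[OF f] by (meson INF_lower2)
        also have "\<dots> = ennreal M * ennreal (BMO_norm \<omega> \<rho> f) + ennreal e"
          using M e BMO_norm_nonneg[OF f]
          by (simp add: distrib_left ennreal_mult[symmetric] ennreal_plus[symmetric] del: ennreal_plus)
        finally show "?I \<le> ennreal M * ennreal (BMO_norm \<omega> \<rho> f) + ennreal e" .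
      qed
    qed
    moreover have "(4::real) > 0" by simp
    ultimately show "\<exists>A>0. \<exists>A'>0. \<forall>f :: 'a \<Rightarrow> 'b. f \<in> BMO_space \<omega> \<rho> \<longrightarrow>
      ennreal (BMO_norm \<omega> \<rho> f) \<le>
        ennreal A * (INF c\<in>admissible_families \<omega> \<rho> p f. max (osc_const \<omega> p f c) (log_const \<rho> c)) \<and>
      (INF c\<in>admissible_families \<omega> \<rho> p f. max (osc_const \<omega> p f c) (log_const \<rho> c)) \<le>
        ennreal A' * ennreal (BMO_norm \<omega> \<rho> f)"
      using M by blast
  qed
qed

end

section \<open>The critical radius of a reverse Hoelder potential\<close>

context doubling_measure
begin

text \<open>The mean over the small ball is at most twice its \<open>L\<^sup>q\<close>-mean, which exceeds the \<open>L\<^sup>q\<close>-mean over the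
  large ball by a factor of at most \<open>(\<kappa> (s/r)\<^bsup>N\<^esup>)\<^bsup>1/q\<^esup>\<close>; the reverse Hoelder inequality returns to the mean.\<close>

lemma reverse_Hoelder_mean_growth:
  fixes V :: "'a \<Rightarrow> real"
  assumes V: "\<And>x. 0 \<le> V x" and q: "1 < q" and RH: "reverse_Hoelder \<omega> q V"
  shows "\<exists>K>0. \<forall>x r s. 0 < r \<longrightarrow> r \<le> s \<longrightarrow>
    r\<^sup>2 * mean \<omega> (ball x r) V \<le> K * (r / s) powr (2 - N / q) * (s\<^sup>2 * mean \<omega> (ball x s) V)"
proof -
  obtain C where C: "0 < C" and le: "\<And>x s. 0 < s \<Longrightarrow> Lp_mean \<omega> q (ball x s) V \<le> ennreal (C * mean \<omega> (ball x s) V)"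
    using RH unfolding reverse_Hoelder_def by blast
  have loc: "locally_integrable \<omega> V" using RH unfolding reverse_Hoelder_def by blast
  have nV: "(\<lambda>x. norm (V x)) = V" using V by auto
  define K where "K = 2 * C * \<kappa> powr (1/q)"
  have K: "0 < K" unfolding K_def using C kappa_ge_1 by simp
  have "r\<^sup>2 * mean \<omega> (ball x r) V \<le> K * (r / s) powr (2 - N / q) * (s\<^sup>2 * mean \<omega> (ball x s) V)"
    if r: "0 < r" and s: "r \<le> s" for x r s
  proof -
    define m where "m = mean \<omega> (ball x s) V"
    have s0: "0 < s" using r s by simp
    have m: "0 \<le> m" unfolding m_def using mean_norm_nonneg[of \<omega> "ball x s" V] nV by simp
    define T where "T = \<kappa> * (s / r) powr N"
    have T: "0 \<le> T" unfolding T_def using kappa_ge_1 by simp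
    define L where "L = C * m * T powr (1/q)"
    have L: "0 \<le> L" unfolding L_def using C m by simp
    have "(\<integral>\<^sup>+y\<in>ball x r. ennreal (norm (V y) powr q) \<partial>\<omega>) \<le> (\<integral>\<^sup>+y\<in>ball x s. ennreal (norm (V y) powr q) \<partial>\<omega>)"
      using s by (intro nn_integral_mono) (auto simp: indicator_def)
    also have "\<dots> \<le> ennreal ((C * m) powr q) * emeasure \<omega> (ball x s)"
      using le[OF s0, of x] q C m Lp_mean_le_iff[OF ball_finite ball_pos[OF s0], of q "C * m" x V]
      unfolding m_def by simp
    also have "\<dots> \<le> ennreal ((C * m) powr q) * (ennreal T * emeasure \<omega> (ball x r))"
    proof (rule mult_left_mono)
      show "emeasure \<omega> (ball x s) \<le> ennreal T * emeasure \<omega> (ball x r)"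
        unfolding emeasure_ball using ball_growth[OF r s, of x] T unfolding T_def
        by (simp add: ennreal_mult[symmetric] ennreal_leI)
    qed simp
    also have "\<dots> = ennreal ((C * m) powr q * T) * emeasure \<omega> (ball x r)"
      using T by (simp add: ennreal_mult mult.assoc)
    also have "(C * m) powr q * T = L powr q"
      unfolding L_def using C m T q by (simp add: powr_mult powr_powr)
    finally have int: "(\<integral>\<^sup>+y\<in>ball x r. ennreal (norm (V y) powr q) \<partial>\<omega>) \<le> ennreal (L powr q) * emeasure \<omega> (ball x r)" .
    have "mean \<omega> (ball x r) (\<lambda>y. norm (V y)) \<le> 2 * L"
      using q by (intro mean_le_of_powr[OF ball_sets locally_integrable_ball[OF loc] _ L ball_finite ball_pos[OF r] int]) simp
    then have "r\<^sup>2 * mean \<omega> (ball x r) V \<le> r\<^sup>2 * (2 * L)"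
      unfolding nV by (intro mult_left_mono) auto
    also have "2 * L = K * (s / r) powr (N / q) * m"
      unfolding L_def K_def T_def using kappa_ge_1 r s0 by (simp add: powr_mult powr_powr)
    also have "r\<^sup>2 * (K * (s / r) powr (N / q) * m) = K * (r / s) powr (2 - N / q) * (s\<^sup>2 * m)"
    proof -
      have "(r / s) powr (2 - N / q) = (r / s) powr 2 * (r / s) powr (- (N / q))"
        by (simp flip: powr_add)
      also have "(r / s) powr (- (N / q)) = (s / r) powr (N / q)"
        using r s0 by (simp add: powr_minus powr_divide)
      also have "(r / s) powr 2 = (r / s)\<^sup>2" using r s0 by simp
      finally have *: "(r / s) powr (2 - N / q) = (r / s)\<^sup>2 * (s / r) powr (N / q)" .
      have "(r / s)\<^sup>2 * s\<^sup>2 = r\<^sup>2" using s0 by (simp add: power_divide)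
      then show ?thesis unfolding * by (simp add: mult_ac)
    qed
    finally show ?thesis unfolding m_def .
  qed
  then show ?thesis using K by blast
qed

lemma exists_ball_mean_pos:
  fixes V :: "'a \<Rightarrow> real"
  assumes V: "\<And>x. 0 \<le> V x" and loc: "locally_integrable \<omega> V" and nz: "\<not> (AE x in \<omega>. V x = 0)"
  shows "\<exists>s>0. 0 < mean \<omega> (ball x s) V"
proof (rule ccontr)
  assume "\<not> ?thesis"
  then have le: "mean \<omega> (ball x s) V \<le> 0" if "0 < s" for s
    using that by (meson not_le)
  have nV: "(\<lambda>x. norm (V x)) = V" using V by auto
  have Vm: "V \<in> borel_measurable \<omega>" using loc by (rule locally_integrable_measurable)
  have "AE y in \<omega>. y \<in> ball x (real (Suc n)) \<longrightarrow> V y = 0" for n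
  proof -
    let ?s = "real (Suc n)"
    have "(\<integral>\<^sup>+y\<in>ball x ?s. ennreal (norm (V y)) \<partial>\<omega>) = ennreal (measure \<omega> (ball x ?s) * mean \<omega> (ball x ?s) V)"
      using set_nn_integral_norm_eq_mean[OF locally_integrable_ball[OF loc] ball_finite ball_pos, of ?s x]
      unfolding nV by simp
    also have "\<dots> = 0"
      using le[of ?s] by (intro ennreal_neg mult_nonneg_nonpos) auto
    finally have "AE y in \<omega>. ennreal (norm (V y)) * indicator (ball x ?s) y = 0"
      using Vm ball_sets by (subst (asm) nn_integral_0_iff_AE) auto
    then show ?thesis by eventually_elim (auto simp: indicator_def split: if_splits)
  qed
  then have "AE y in \<omega>. \<forall>n. y \<in> ball x (real (Suc n)) \<longrightarrow> V y = 0"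
    by (subst AE_all_countable) (rule allI)
  then have "AE y in \<omega>. V y = 0"
  proof eventually_elim
    case (elim y)
    obtain n where "dist x y < real n" using reals_Archimedean2 by blast
    then show ?case using elim[rule_format, of n] by simp
  qed
  then show False using nz by blast
qed

text \<open>The supremum is positive as soon as the set of admissible radii is nonempty and bounded. By
  \<open>reverse_Hoelder_mean_growth\<close> the function \<open>h\<close> tends to \<open>0\<close> at \<open>0\<close>, which gives an admissible
  radius, and it exceeds \<open>1\<close> for large radii because it is positive at some radius.\<close>

theorem critical_radius_pos:
  fixes V :: "'a \<Rightarrow> real"
  assumes V: "\<And>x. 0 \<le> V x" and nz: "\<not> (AE x in \<omega>. V x = 0)"
    and q: "1 < q" "N / 2 < q" and RH: "reverse_Hoelder \<omega> q V"
  shows "0 < critical_radius \<omega> V x"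
proof -
  have loc: "locally_integrable \<omega> V" using RH unfolding reverse_Hoelder_def by blast
  have nV: "(\<lambda>x. norm (V x)) = V" using V by auto
  define h where "h r = r\<^sup>2 * mean \<omega> (ball x r) V" for r
  define \<epsilon> where "\<epsilon> = 2 - N / q"
  have eps: "0 < \<epsilon>" unfolding \<epsilon>_def using q by (simp add: field_simps)
  have h0: "0 \<le> h r" for r
    unfolding h_def using mean_norm_nonneg[of \<omega> "ball x r" V] nV by simp
  obtain K where K: "0 < K" and growth: "\<And>r s. 0 < r \<Longrightarrow> r \<le> s \<Longrightarrow> h r \<le> K * (r / s) powr \<epsilon> * h s"
    using reverse_Hoelder_mean_growth[OF V q(1) RH] unfolding h_def \<epsilon>_def by blast
  define S where "S = {r. 0 < r \<and> h r \<le> 1}"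
  obtain t where t: "t \<in> S"
  proof -
    define c where "c = K * h 1 + 1"
    have c: "1 \<le> c" unfolding c_def using K h0[of 1] by simp
    \<comment> \<open>Chosen so that \<open>K t\<^bsup>\<epsilon>\<^esup> h 1 \<le> 1\<close>, and \<open>t \<le> 1\<close>.\<close>
    define t where "t = (1 / c) powr (1 / \<epsilon>)"
    have t: "0 < t" unfolding t_def using c by simp
    have "(1 / c) powr (1 / \<epsilon>) \<le> 1 powr (1 / \<epsilon>)" using c eps by (intro powr_mono2) auto
    then have t1: "t \<le> 1" unfolding t_def by simp
    have te: "t powr \<epsilon> = 1 / c" unfolding t_def using c eps by (simp add: powr_powr)
    have "h t \<le> K * t powr \<epsilon> * h 1" using growth[OF t t1] by simp
    also have "\<dots> = (K * h 1) / c" unfolding te by simp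
    also have "\<dots> \<le> 1" using c unfolding c_def by simp
    finally have "t \<in> S" unfolding S_def using t by simp
    then show ?thesis using that by blast
  qed
  have "bdd_above S"
  proof -
    obtain s where s: "0 < s" "0 < mean \<omega> (ball x s) V"
      using exists_ball_mean_pos[OF V loc nz] by blast
    have hs: "0 < h s" unfolding h_def using s by simp
    have "r \<le> s + s * (K / h s) powr (1 / \<epsilon>)" if r: "r \<in> S" for r
    proof (cases "r \<le> s")
      case True
      then show ?thesis using s by (simp add: add_increasing2)
    next
      case False
      have r0: "0 < r" "h r \<le> 1" using r unfolding S_def by auto
      have "h s \<le> K * (s / r) powr \<epsilon> * h r" using growth[of s r] s False by simp
      also have "\<dots> \<le> K * (s / r) powr \<epsilon> * 1" using r0 K by (intro mult_left_mono) auto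
      also have "(s / r) powr \<epsilon> = 1 / (r / s) powr \<epsilon>" using r0 s by (simp add: powr_divide)
      finally have "(r / s) powr \<epsilon> \<le> K / h s"
        using hs r0 s by (simp add: field_simps)
      then have "((r / s) powr \<epsilon>) powr (1 / \<epsilon>) \<le> (K / h s) powr (1 / \<epsilon>)"
        using eps by (intro powr_mono2) auto
      then have "r / s \<le> (K / h s) powr (1 / \<epsilon>)" using eps r0 s by (simp add: powr_powr)
      then have "r \<le> s * (K / h s) powr (1 / \<epsilon>)" using s by (simp add: field_simps)
      then show ?thesis using s by simp
    qed
    then show ?thesis by (rule bdd_aboveI)
  qed
  then have "t \<le> Sup S" using t by (intro cSup_upper)
  moreover have "0 < t" using t unfolding S_def by simp
  ultimately show ?thesis unfolding critical_radius_def S_def h_def by simp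
qed

end

section \<open>The Dunkl measure is doubling\<close>

lemma dunkl_weight_nonneg: "0 \<le> dunkl_weight R b k x"
  unfolding dunkl_weight_def by (intro prod_nonneg) auto

lemma dunkl_weight_pos:
  assumes "\<And>\<zeta>. \<zeta> \<in> pos_roots R b \<Longrightarrow> \<zeta> \<bullet> x \<noteq> 0"
  shows "0 < dunkl_weight R b k x"
  unfolding dunkl_weight_def using assms by (intro prod_pos) auto

lemma dunkl_weight_borel:
  fixes R :: "'a::euclidean_space set"
  shows "dunkl_weight R b k \<in> borel_measurable borel"
  unfolding dunkl_weight_def
proof (rule borel_measurable_prod)
  fix \<zeta>
  show "(\<lambda>x. if k \<zeta> = 0 then 1 else \<bar>\<zeta> \<bullet> x\<bar> powr (2 * k \<zeta>)) \<in> borel_measurable borel"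
    by (cases "k \<zeta> = 0") simp_all
qed

lemma dunkl_weight_lebesgue:
  fixes R :: "'a::euclidean_space set"
  shows "(\<lambda>x. ennreal (dunkl_weight R b k x)) \<in> borel_measurable lebesgue"
  by (intro measurable_completion) (use dunkl_weight_borel in measurable)

text \<open>The weight is monotone in the distances to the reflecting hyperplanes and homogeneous of degree
  \<open>2\<gamma>\<close> in them.\<close>

lemma dunkl_weight_le:
  assumes P: "finite (pos_roots R b)" and k: "\<And>\<zeta>. \<zeta> \<in> pos_roots R b \<Longrightarrow> 0 \<le> k \<zeta>" and t: "0 < t"
    and le: "\<And>\<zeta>. \<zeta> \<in> pos_roots R b \<Longrightarrow> \<bar>\<zeta> \<bullet> y\<bar> \<le> t * \<bar>\<zeta> \<bullet> z\<bar>"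
  shows "dunkl_weight R b k y \<le> t powr (2 * dunkl_gamma R b k) * dunkl_weight R b k z"
proof -
  let ?w = "\<lambda>x \<zeta>. if k \<zeta> = 0 then 1 else \<bar>\<zeta> \<bullet> x\<bar> powr (2 * k \<zeta>)"
  have "(\<Prod>\<zeta>\<in>pos_roots R b. ?w y \<zeta>) \<le> (\<Prod>\<zeta>\<in>pos_roots R b. t powr (2 * k \<zeta>) * ?w z \<zeta>)"
  proof (rule prod_mono, intro conjI)
    fix \<zeta> assume \<zeta>: "\<zeta> \<in> pos_roots R b"
    have "\<bar>\<zeta> \<bullet> y\<bar> powr (2 * k \<zeta>) \<le> (t * \<bar>\<zeta> \<bullet> z\<bar>) powr (2 * k \<zeta>)"
      using le[OF \<zeta>] k[OF \<zeta>] by (intro powr_mono2) auto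
    also have "\<dots> = t powr (2 * k \<zeta>) * \<bar>\<zeta> \<bullet> z\<bar> powr (2 * k \<zeta>)"
      using t by (simp add: powr_mult)
    finally show "?w y \<zeta> \<le> t powr (2 * k \<zeta>) * ?w z \<zeta>" using t by simp
  qed auto
  also have "\<dots> = t powr (\<Sum>\<zeta>\<in>pos_roots R b. 2 * k \<zeta>) * (\<Prod>\<zeta>\<in>pos_roots R b. ?w z \<zeta>)"
    using t P by (simp add: prod.distrib powr_sum)
  finally show ?thesis
    unfolding dunkl_weight_def dunkl_gamma_def by (simp add: sum_distrib_left)
qed

text \<open>Consider \<open>card P + 1\<close> equally spaced points on a segment from \<open>x\<close> in a direction \<open>e\<close> transversal to
  all hyperplanes. Their spacing is so large that a hyperplane can be close to at most one of
  them, so by the pigeonhole principle some point is far from all hyperplanes.\<close>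

lemma exists_point_off_hyperplanes:
  fixes P :: "'a::real_inner set"
  assumes P: "finite P" and e: "norm e \<le> 1" and m: "0 < m" "\<And>\<zeta>. \<zeta> \<in> P \<Longrightarrow> m \<le> \<bar>\<zeta> \<bullet> e\<bar>" and r: "0 < r"
  shows "\<exists>y. norm (y - x) \<le> r / 2 \<and> (\<forall>\<zeta>\<in>P. m / (4 * (real (card P) + 1)) * r \<le> \<bar>\<zeta> \<bullet> y\<bar>)"
proof -
  define M where "M = real (card P) + 1"
  \<comment> \<open>The spacing of the \<open>M\<close> points: they stay within \<open>r / 2\<close> of \<open>x\<close>, and along \<open>e\<close> two of them
    differ by at least \<open>h m = 2d\<close> in their inner product with any vector of \<open>P\<close>.\<close>
  define h where "h = r / (2 * M)"
  define y where "y j = x + (real j * h) *\<^sub>R e" for j :: nat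
  define d where "d = m / (4 * M) * r"
  have M: "0 < M" unfolding M_def by simp
  have h: "0 < h" unfolding h_def using r M by simp
  have hd: "h * m = 2 * d" unfolding h_def d_def using M by (simp add: field_simps)
  have "\<exists>j\<le>card P. \<forall>\<zeta>\<in>P. d \<le> \<bar>\<zeta> \<bullet> y j\<bar>"
  proof (rule ccontr)
    assume "\<not> ?thesis"
    then have "\<forall>j\<in>{..card P}. \<exists>\<zeta>. \<zeta> \<in> P \<and> \<bar>\<zeta> \<bullet> y j\<bar> < d"
      by (metis atMost_iff not_le)
    then obtain g where g: "\<forall>j\<in>{..card P}. g j \<in> P \<and> \<bar>g j \<bullet> y j\<bar> < d"
      by (rule bchoice[THEN exE])
    then have "g ` {..card P} \<subseteq> P" by auto
    then have "card (g ` {..card P}) < card {..card P}"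
      using card_mono[OF P] by (simp add: le_imp_less_Suc)
    then have "\<not> inj_on g {..card P}" by (rule pigeonhole)
    then obtain i j where ij: "i \<le> card P" "j \<le> card P" "i < j" "g i = g j"
      unfolding inj_on_def by (metis atMost_iff linorder_neqE_nat)
    let ?\<zeta> = "g i"
    have b: "\<bar>?\<zeta> \<bullet> y i\<bar> < d" "?\<zeta> \<in> P" "\<bar>?\<zeta> \<bullet> y j\<bar> < d"
      using g[rule_format, of i] g[rule_format, of j] ij by simp_all
    have "y j - y i = ((real j - real i) * h) *\<^sub>R e"
      unfolding y_def by (simp add: algebra_simps)
    then have "?\<zeta> \<bullet> y j - ?\<zeta> \<bullet> y i = (real j - real i) * h * (?\<zeta> \<bullet> e)"
      by (metis inner_diff_right inner_scaleR_right)
    then have "\<bar>?\<zeta> \<bullet> y j - ?\<zeta> \<bullet> y i\<bar> = (real j - real i) * h * \<bar>?\<zeta> \<bullet> e\<bar>"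
      using ij h by (simp add: abs_mult)
    moreover have "1 * h * m \<le> (real j - real i) * h * \<bar>?\<zeta> \<bullet> e\<bar>"
      using ij h m(1) m(2)[OF b(2)] by (intro mult_mono) auto
    ultimately have "2 * d \<le> \<bar>?\<zeta> \<bullet> y j - ?\<zeta> \<bullet> y i\<bar>"
      unfolding hd[symmetric] by simp
    also have "\<dots> \<le> \<bar>?\<zeta> \<bullet> y j\<bar> + \<bar>?\<zeta> \<bullet> y i\<bar>" by (rule abs_triangle_ineq4)
    also have "\<dots> < d + d" using b by (intro add_strict_mono)
    finally show False by simp
  qed
  then obtain j where j: "j \<le> card P" "\<forall>\<zeta>\<in>P. d \<le> \<bar>\<zeta> \<bullet> y j\<bar>" by blast
  have "norm (y j - x) = real j * h * norm e" unfolding y_def using h by simp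
  also have "\<dots> \<le> M * h * 1"
    using j h e unfolding M_def by (intro mult_mono) auto
  also have "\<dots> = r / 2" unfolding h_def using M by simp
  finally show ?thesis using j unfolding d_def M_def by blast
qed

lemma emeasure_dunkl_measure:
  "A \<in> sets lebesgue \<Longrightarrow>
    emeasure (dunkl_measure R b k) A = (\<integral>\<^sup>+x\<in>A. ennreal (dunkl_weight R b k x) \<partial>lebesgue)"
  unfolding dunkl_measure_def by (simp add: emeasure_density dunkl_weight_lebesgue)

lemma AE_dunkl_weight_pos:
  fixes R :: "'a::euclidean_space set"
  assumes P: "finite (pos_roots R b)"
  shows "AE x in lebesgue. 0 < dunkl_weight R b k x"
proof -
  have "AE x in lebesgue. \<zeta> \<bullet> x \<noteq> 0" if "\<zeta> \<in> pos_roots R b" for \<zeta>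
  proof -
    have "\<zeta> \<noteq> 0" using that unfolding pos_roots_def by auto
    then have "negligible {x. \<zeta> \<bullet> x = 0}" by (rule negligible_hyperplane[OF disjI1])
    then have "{x. \<zeta> \<bullet> x = 0} \<in> null_sets lebesgue" by (simp add: negligible_iff_null_sets)
    then show ?thesis by (rule AE_I') auto
  qed
  then have "AE x in lebesgue. \<forall>\<zeta>\<in>pos_roots R b. \<zeta> \<bullet> x \<noteq> 0"
    using P by (intro AE_finite_allI) auto
  then show ?thesis by eventually_elim (intro dunkl_weight_pos, auto)
qed

text \<open>The weight vanishes only on finitely many hyperplanes, so both measures have the same null
  sets.\<close>

lemma AE_dunkl_measure_iff:
  fixes R :: "'a::euclidean_space set"
  assumes P: "finite (pos_roots R b)"
  shows "(AE x in dunkl_measure R b k. Q x) \<longleftrightarrow> (AE x in lebesgue. Q x)"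
  unfolding dunkl_measure_def AE_density[OF dunkl_weight_lebesgue]
proof
  assume "AE x in lebesgue. 0 < ennreal (dunkl_weight R b k x) \<longrightarrow> Q x"
  then show "AE x in lebesgue. Q x"
    using AE_dunkl_weight_pos[OF P, of k] by eventually_elim simp
qed (elim AE_mp, auto)

text \<open>The setting of the measure estimates: finitely many vectors of length \<open>sqrt 2\<close> with nonnegative
  multiplicities, of which those on the positive side of \<open>b\<close> enter the weight.\<close>

locale root_configuration =
  fixes R :: "'a::euclidean_space set" and b :: 'a and k :: "'a \<Rightarrow> real"
  assumes finite_roots: "finite R"
    and root_norm: "\<zeta> \<in> R \<Longrightarrow> (norm \<zeta>)\<^sup>2 = 2"
    and k_nonneg: "\<zeta> \<in> R \<Longrightarrow> 0 \<le> k \<zeta>"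
begin

abbreviation "P \<equiv> pos_roots R b"
abbreviation "w \<equiv> dunkl_weight R b k"
abbreviation "\<gamma> \<equiv> dunkl_gamma R b k"
abbreviation "\<mu> \<equiv> dunkl_measure R b k"

lemma finite_P: "finite P"
  using finite_roots unfolding pos_roots_def by auto

lemma k_P: "\<zeta> \<in> P \<Longrightarrow> 0 \<le> k \<zeta>"
  using k_nonneg unfolding pos_roots_def by auto

lemma gamma_nonneg: "0 \<le> \<gamma>"
  unfolding dunkl_gamma_def by (intro sum_nonneg k_P)

lemma inner_root_le: "\<zeta> \<in> P \<Longrightarrow> \<bar>\<zeta> \<bullet> x\<bar> \<le> 2 * norm x"
proof -
  assume "\<zeta> \<in> P"
  then have "(norm \<zeta>)\<^sup>2 \<le> 2\<^sup>2" using root_norm[of \<zeta>] unfolding pos_roots_def by auto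
  then have "norm \<zeta> \<le> 2" by (rule power2_le_imp_le) simp
  then show ?thesis
    using Cauchy_Schwarz_ineq2[of \<zeta> x] mult_right_mono[of "norm \<zeta>" 2 "norm x"] by simp
qed

lemma ex_direction: "\<exists>e m. norm e \<le> 1 \<and> 0 < m \<and> m \<le> 1 \<and> (\<forall>\<zeta>\<in>P. m \<le> \<bar>\<zeta> \<bullet> e\<bar>)"
proof (intro exI conjI)
  \<comment> \<open>The summand \<open>1\<close> keeps the denominator positive when \<open>b = 0\<close>.\<close>
  define e where "e = (1 / (1 + norm b)) *\<^sub>R b"
  define m where "m = Min (insert 1 ((\<lambda>\<zeta>. \<bar>\<zeta> \<bullet> e\<bar>) ` P))"
  have nb: "0 < 1 + norm b" by (simp add: add_pos_nonneg)
  show "norm e \<le> 1" unfolding e_def using nb by (simp add: divide_le_eq)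
  have "\<zeta> \<bullet> e \<noteq> 0" if "\<zeta> \<in> P" for \<zeta>
    using that nb unfolding e_def pos_roots_def by auto
  then show "0 < m" unfolding m_def using finite_P by (subst Min_gr_iff) auto
  show "m \<le> 1" unfolding m_def using finite_P by (intro Min_le) auto
  show "\<forall>\<zeta>\<in>P. m \<le> \<bar>\<zeta> \<bullet> e\<bar>" unfolding m_def using finite_P by (intro ballI Min_le) auto
qed

lemma weight_bounded: "\<exists>W>0. \<forall>x\<in>ball 0 r. w x \<le> W"
proof -
  obtain e m where e: "norm e \<le> 1" "0 < m" "\<forall>\<zeta>\<in>P. m \<le> \<bar>\<zeta> \<bullet> e\<bar>"
    using ex_direction by blast
  \<comment> \<open>At \<open>e\<close> every \<open>|\<langle>\<zeta>, e\<rangle>|\<close> is at least \<open>m\<close>, so \<open>t\<close> times it dominates the values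
    on the ball of radius \<open>r\<close>.\<close>
  define t where "t = 2 * \<bar>r\<bar> / m + 1"
  have t: "0 < t" unfolding t_def using e by (simp add: add_nonneg_pos)
  have "w x \<le> t powr (2 * \<gamma>) * w e" if x: "x \<in> ball 0 r" for x
  proof (rule dunkl_weight_le[OF finite_P k_P t])
    fix \<zeta> assume \<zeta>: "\<zeta> \<in> P"
    have "\<bar>\<zeta> \<bullet> x\<bar> \<le> 2 * \<bar>r\<bar>" using inner_root_le[OF \<zeta>, of x] x by simp
    also have "\<dots> \<le> t * m" unfolding t_def using e by (simp add: field_simps)
    also have "\<dots> \<le> t * \<bar>\<zeta> \<bullet> e\<bar>" using t e \<zeta> by (intro mult_left_mono) auto
    finally show "\<bar>\<zeta> \<bullet> x\<bar> \<le> t * \<bar>\<zeta> \<bullet> e\<bar>" .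
  qed auto
  then have "\<forall>x\<in>ball 0 r. w x \<le> t powr (2 * \<gamma>) * w e + 1" by fastforce
  moreover have "0 < t powr (2 * \<gamma>) * w e + 1"
    by (intro add_nonneg_pos mult_nonneg_nonneg dunkl_weight_nonneg) auto
  ultimately show ?thesis by blast
qed

lemma emeasure_le:
  assumes A: "A \<in> sets lebesgue" and W: "0 \<le> W" "\<And>x. x \<in> A \<Longrightarrow> w x \<le> W"
  shows "emeasure \<mu> A \<le> ennreal W * emeasure lebesgue A"
proof -
  have "(\<integral>\<^sup>+x\<in>A. ennreal (w x) \<partial>lebesgue) \<le> (\<integral>\<^sup>+x\<in>A. ennreal W \<partial>lebesgue)"
    using W by (intro nn_integral_mono) (auto simp: indicator_def ennreal_leI)
  then show ?thesis
    using A by (simp add: emeasure_dunkl_measure nn_integral_cmult_indicator)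
qed

lemma emeasure_ball_finite: "emeasure \<mu> (ball x r) < \<infinity>"
proof -
  obtain W where W: "0 < W" "\<forall>u\<in>ball 0 (norm x + r). w u \<le> W" using weight_bounded by blast
  have sub: "ball x r \<subseteq> ball 0 (norm x + r)"
  proof
    fix u assume "u \<in> ball x r"
    then show "u \<in> ball 0 (norm x + r)"
      using norm_triangle_ineq[of x "u - x"] by (simp add: dist_norm norm_minus_commute)
  qed
  have "emeasure \<mu> (ball x r) \<le> ennreal W * emeasure lebesgue (ball x r)"
    using W sub by (intro emeasure_le) auto
  also have "\<dots> < \<infinity>"
    using emeasure_lborel_ball_finite[of x r] by (simp add: ennreal_mult_less_top)
  finally show ?thesis .
qed

text \<open>Near the point \<open>y\<close> of \<open>exists_point_off_hyperplanes\<close> all \<open>|\<langle>\<zeta>, z\<rangle>|\<close> are at least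
  \<open>\<delta> r / 2\<close>, so a value \<open>|\<langle>\<zeta>, u\<rangle>|\<close> on \<open>B(x,s)\<close> exceeds \<open>|\<langle>\<zeta>, z\<rangle>|\<close> by a factor of at
  most \<open>9s / (\<delta> r)\<close>. Comparing the weights and integrating over \<open>z\<close> gives the factor
  \<open>(s/r)\<^bsup>2\<gamma>\<^esup>\<close>; the remaining \<open>(s/r)\<^bsup>n\<^esup>\<close> is the ratio of the Lebesgue measures.\<close>

lemma ball_growth_exists:
  "\<exists>\<kappa>. \<forall>x r s. 0 < r \<longrightarrow> r \<le> s \<longrightarrow>
    measure \<mu> (ball x s) \<le> \<kappa> * (s / r) powr (real DIM('a) + 2 * \<gamma>) * measure \<mu> (ball x r)"
proof -
  obtain e m where e: "norm e \<le> 1" "0 < m" "m \<le> 1" "\<forall>\<zeta>\<in>P. m \<le> \<bar>\<zeta> \<bullet> e\<bar>"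
    using ex_direction by blast
  define \<delta> where "\<delta> = m / (4 * (real (card P) + 1))"
  have \<delta>: "0 < \<delta>" "\<delta> \<le> 1" unfolding \<delta>_def using e by (auto simp: field_simps)
  define \<kappa> where "\<kappa> = (9 / \<delta>) powr (2 * \<gamma>) * (4 / \<delta>) ^ DIM('a)"
  have "measure \<mu> (ball x s) \<le> \<kappa> * (s / r) powr (real DIM('a) + 2 * \<gamma>) * measure \<mu> (ball x r)"
    if r: "0 < r" and s: "r \<le> s" for x and r s :: real
  proof -
    obtain y where y: "norm (y - x) \<le> r / 2" "\<forall>\<zeta>\<in>P. \<delta> * r \<le> \<bar>\<zeta> \<bullet> y\<bar>"
      using exists_point_off_hyperplanes[OF finite_P e(1,2) _ r, of x] e unfolding \<delta>_def by blast
    define S where "S = ball y (\<delta> * r / 4)"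
    define t where "t = 9 / \<delta> * (s / r)"
    have t: "0 < t" unfolding t_def using \<delta> r s by simp
    have dr: "0 < \<delta> * r" "\<delta> * r \<le> r" using \<delta> r by auto
    have S_sub: "S \<subseteq> ball x r"
    proof
      fix z assume "z \<in> S"
      then have "norm (z - y) < r / 4" unfolding S_def using dr by (simp add: dist_norm norm_minus_commute)
      moreover have "norm (z - x) \<le> norm (z - y) + norm (y - x)"
        using norm_triangle_ineq[of "z - y" "y - x"] by simp
      ultimately show "z \<in> ball x r"
        using y r by (simp add: dist_norm norm_minus_commute)
    qed
    have cmp: "w u \<le> t powr (2 * \<gamma>) * w z" if u: "u \<in> ball x s" and z: "z \<in> S" for u z
    proof (rule dunkl_weight_le[OF finite_P k_P t])
      fix \<zeta> assume \<zeta>: "\<zeta> \<in> P"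
      have "norm (z - y) \<le> \<delta> * r / 4" using z unfolding S_def by (simp add: dist_norm norm_minus_commute)
      then have "\<bar>\<zeta> \<bullet> (z - y)\<bar> \<le> \<delta> * r / 2" using inner_root_le[OF \<zeta>, of "z - y"] by simp
      moreover have "\<delta> * r \<le> \<bar>\<zeta> \<bullet> y\<bar>" using y \<zeta> by blast
      moreover have "\<zeta> \<bullet> z = \<zeta> \<bullet> y + \<zeta> \<bullet> (z - y)" by (simp add: inner_diff_right)
      ultimately have low: "\<delta> * r / 2 \<le> \<bar>\<zeta> \<bullet> z\<bar>" by linarith
      have "norm (z - x) < r" using S_sub z by (auto simp: dist_norm norm_minus_commute)
      moreover have "norm (u - x) < s" using u by (simp add: dist_norm norm_minus_commute)
      moreover have "norm (u - z) \<le> norm (u - x) + norm (z - x)"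
        using norm_triangle_ineq4[of "u - x" "z - x"] by simp
      ultimately have "norm (u - z) \<le> 2 * s" using s by linarith
      then have "\<bar>\<zeta> \<bullet> (u - z)\<bar> \<le> 4 * s" using inner_root_le[OF \<zeta>, of "u - z"] by simp
      moreover have "\<zeta> \<bullet> u = \<zeta> \<bullet> z + \<zeta> \<bullet> (u - z)" by (simp add: inner_diff_right)
      ultimately have "\<bar>\<zeta> \<bullet> u\<bar> \<le> \<bar>\<zeta> \<bullet> z\<bar> + 4 * s" by linarith
      also have "4 * s = 8 / \<delta> * (s / r) * (\<delta> * r / 2)" using \<delta> r by simp
      also have "\<dots> \<le> 8 / \<delta> * (s / r) * \<bar>\<zeta> \<bullet> z\<bar>" using low \<delta> r s by (intro mult_left_mono) auto
      also have "\<bar>\<zeta> \<bullet> z\<bar> + 8 / \<delta> * (s / r) * \<bar>\<zeta> \<bullet> z\<bar> \<le> 1 / \<delta> * (s / r) * \<bar>\<zeta> \<bullet> z\<bar> + 8 / \<delta> * (s / r) * \<bar>\<zeta> \<bullet> z\<bar>"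
      proof -
        have "1 * 1 \<le> 1 / \<delta> * (s / r)" using \<delta> r s by (intro mult_mono) auto
        then have "1 * \<bar>\<zeta> \<bullet> z\<bar> \<le> 1 / \<delta> * (s / r) * \<bar>\<zeta> \<bullet> z\<bar>" by (intro mult_right_mono) auto
        then show ?thesis by (intro add_right_mono) simp
      qed
      also have "\<dots> = t * \<bar>\<zeta> \<bullet> z\<bar>" unfolding t_def by (simp add: field_simps)
      finally show "\<bar>\<zeta> \<bullet> u\<bar> \<le> t * \<bar>\<zeta> \<bullet> z\<bar>" by simp
    qed auto
    define T where "T = t powr (2 * \<gamma>)"
    have T: "0 \<le> T" unfolding T_def by simp
    have "emeasure \<mu> (ball x s) * emeasure lebesgue S = (\<integral>\<^sup>+z\<in>S. emeasure \<mu> (ball x s) \<partial>lebesgue)"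
      unfolding S_def by (simp add: nn_integral_cmult_indicator)
    also have "\<dots> \<le> (\<integral>\<^sup>+z. ennreal T * emeasure lebesgue (ball x s) * (ennreal (w z) * indicator S z) \<partial>lebesgue)"
    proof (intro nn_integral_mono)
      fix z
      show "emeasure \<mu> (ball x s) * indicator S z
        \<le> ennreal T * emeasure lebesgue (ball x s) * (ennreal (w z) * indicator S z)"
      proof (cases "z \<in> S")
        case True
        have "emeasure \<mu> (ball x s) \<le> ennreal (T * w z) * emeasure lebesgue (ball x s)"
          using cmp[OF _ True] T dunkl_weight_nonneg[of R b k z] unfolding T_def by (intro emeasure_le) auto
        also have "\<dots> = ennreal T * emeasure lebesgue (ball x s) * ennreal (w z)"
          using T by (simp add: ennreal_mult' mult_ac)
        finally show ?thesis using True by simp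
      qed simp
    qed
    also have "\<dots> = ennreal T * emeasure lebesgue (ball x s) * emeasure \<mu> S"
      unfolding S_def
      by (subst nn_integral_cmult)
        (auto simp: emeasure_dunkl_measure intro!: borel_measurable_times_ennreal dunkl_weight_lebesgue
          borel_measurable_indicator)
    also have "\<dots> \<le> ennreal T * emeasure lebesgue (ball x s) * emeasure \<mu> (ball x r)"
      using S_sub by (intro mult_left_mono emeasure_mono) (auto simp: dunkl_measure_def)
    finally have main: "emeasure \<mu> (ball x s) * emeasure lebesgue S
      \<le> ennreal T * emeasure lebesgue (ball x s) * emeasure \<mu> (ball x r)" .
    define v where "v = unit_ball_vol (real DIM('a))"
    have v: "0 < v" unfolding v_def by simp
    have eS: "emeasure lebesgue S = ennreal (v * (\<delta> * r / 4) ^ DIM('a))"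
      unfolding S_def v_def using dr by (simp add: emeasure_ball)
    have es: "emeasure lebesgue (ball x s) = ennreal (v * s ^ DIM('a))"
      unfolding v_def using r s by (simp add: emeasure_ball)
    have em: "emeasure \<mu> (ball x s') = ennreal (measure \<mu> (ball x s'))" for s'
      using emeasure_ball_finite[of x s'] by (simp add: emeasure_eq_ennreal_measure)
    have "measure \<mu> (ball x s) * (v * (\<delta> * r / 4) ^ DIM('a)) \<le> T * (v * s ^ DIM('a)) * measure \<mu> (ball x r)"
    proof -
      have "0 \<le> v * s ^ DIM('a)" "0 \<le> v * (\<delta> * r / 4) ^ DIM('a)" using v r s dr by auto
      then show ?thesis
        using main T unfolding em eS es
        by (simp add: ennreal_mult[symmetric] ennreal_le_iff mult_nonneg_nonneg)
    qed
    then have "v * (measure \<mu> (ball x s) * (\<delta> * r / 4) ^ DIM('a)) \<le> v * (T * s ^ DIM('a) * measure \<mu> (ball x r))"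
      by (simp add: mult_ac)
    then have "measure \<mu> (ball x s) * (\<delta> * r / 4) ^ DIM('a) \<le> T * s ^ DIM('a) * measure \<mu> (ball x r)"
      using v by simp
    then have "measure \<mu> (ball x s) \<le> T * s ^ DIM('a) * measure \<mu> (ball x r) / (\<delta> * r / 4) ^ DIM('a)"
      using dr by (subst pos_le_divide_eq) auto
    also have "\<dots> = T * (s / (\<delta> * r / 4)) ^ DIM('a) * measure \<mu> (ball x r)"
      by (simp add: power_divide)
    also have "s / (\<delta> * r / 4) = 4 / \<delta> * (s / r)" by simp
    also have "T = (9 / \<delta>) powr (2 * \<gamma>) * (s / r) powr (2 * \<gamma>)"
      unfolding T_def t_def by (rule powr_mult)
    also have "(9 / \<delta>) powr (2 * \<gamma>) * (s / r) powr (2 * \<gamma>) * (4 / \<delta> * (s / r)) ^ DIM('a) * measure \<mu> (ball x r)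
      = \<kappa> * (s / r) powr (real DIM('a) + 2 * \<gamma>) * measure \<mu> (ball x r)"
      unfolding \<kappa>_def power_mult_distrib powr_add using r s by (simp add: powr_realpow)
    finally show ?thesis .
  qed
  then show ?thesis by blast
qed

theorem dunkl_measure_doubling: "\<exists>\<kappa>. doubling_measure \<mu> \<kappa> (real DIM('a) + 2 * \<gamma>)"
proof -
  obtain \<kappa> where growth: "\<forall>x r s. 0 < r \<longrightarrow> r \<le> s \<longrightarrow>
    measure \<mu> (ball x s) \<le> \<kappa> * (s / r) powr (real DIM('a) + 2 * \<gamma>) * measure \<mu> (ball x r)"
    using ball_growth_exists by blast
  have "doubling_measure \<mu> \<kappa> (real DIM('a) + 2 * \<gamma>)"
  proof
    show "sets \<mu> = sets lebesgue" by (simp add: dunkl_measure_def)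
    show "0 \<le> real DIM('a) + 2 * \<gamma>" using gamma_nonneg by simp
    show "measure \<mu> (ball x s) \<le> \<kappa> * (s / r) powr (real DIM('a) + 2 * \<gamma>) * measure \<mu> (ball x r)"
      if "0 < r" "r \<le> s" for x r s using growth that by blast
    show "0 < emeasure \<mu> (ball x r)" if r: "0 < r" for x r
    proof (rule ccontr)
      assume "\<not> 0 < emeasure \<mu> (ball x r)"
      then have "ball x r \<in> null_sets \<mu>"
        by (auto simp: null_sets_def dunkl_measure_def)
      then have "AE u in \<mu>. u \<notin> ball x r" by (rule AE_not_in)
      then have "AE u in lebesgue. u \<notin> ball x r" unfolding AE_dunkl_measure_iff[OF finite_P] .
      then have "emeasure lebesgue (ball x r) = 0"
        by (subst (asm) AE_iff_measurable[of "ball x r"]) auto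
      then show False using r unit_ball_vol_pos[of "real DIM('a)"] by (simp add: emeasure_ball)
    qed
    show "emeasure \<mu> (ball x r) < \<infinity>" for x r by (rule emeasure_ball_finite)
    show "\<exists>U. open U \<and> F \<subseteq> U \<and> emeasure \<mu> (U - F) \<le> ennreal e"
      if F: "F \<in> sets lebesgue" "bounded F" and e: "0 < e" for F e
    proof -
      obtain r where r: "F \<subseteq> ball 0 r" using bounded_subset_ballD[OF F(2)] by blast
      obtain W where W: "0 < W" "\<forall>u\<in>ball 0 r. w u \<le> W" using weight_bounded by blast
      obtain T where T: "open T" "F \<subseteq> T" "emeasure lebesgue (T - F) < ennreal (e / W)"
        by (rule sets_lebesgue_outer_open[OF F(1), of "e / W"]) (use e W in simp_all)
      let ?U = "T \<inter> ball 0 r"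
      have "?U - F \<in> sets lebesgue" using T F by auto
      then have "emeasure \<mu> (?U - F) \<le> ennreal W * emeasure lebesgue (?U - F)"
        using W by (intro emeasure_le) auto
      also have "\<dots> \<le> ennreal W * emeasure lebesgue (T - F)"
        using T F by (intro mult_left_mono emeasure_mono) auto
      also have "\<dots> \<le> ennreal W * ennreal (e / W)"
        using T by (intro mult_left_mono) auto
      also have "\<dots> = ennreal e" using W e by (simp add: ennreal_mult[symmetric])
      finally show ?thesis using T r by (intro exI[of _ ?U]) auto
    qed
  qed
  then show ?thesis by blast
qed

end

section \<open>The space BMO of the Dunkl-Schroedinger operator\<close>

theorem theorem3p5:
  fixes R :: "(real ^ 'n) set" and b :: "real ^ 'n" and k V :: "real ^ 'n \<Rightarrow> real"
    and p q :: real
    and \<omega> :: "(real ^ 'n) measure" and \<rho> :: "real ^ 'n \<Rightarrow> real"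
  assumes "normalized_root_system R"
    and "\<forall>\<zeta>\<in>R. \<zeta> \<bullet> b \<noteq> 0"
    and "multiplicity_function R k"
    and "\<omega> = dunkl_measure R b k"
    and "\<forall>x. V x \<ge> 0"
    and "\<not> (AE x in lebesgue. V x = 0)"
    and "q > max 1 ((real CARD('n) + 2 * dunkl_gamma R b k) / 2)"
    and "reverse_Hoelder \<omega> q V"
    and "\<rho> = critical_radius \<omega> V"
    and "1 \<le> p"
  shows "(\<forall>f :: real ^ 'n \<Rightarrow> 'b::{real_normed_field,banach,second_countable_topology}.
            locally_integrable \<omega> f \<longrightarrow>
            (f \<in> BMO_space \<omega> \<rho> \<longleftrightarrow>
              (\<exists>c. osc_const \<omega> p f c < \<infinity> \<and> log_const \<rho> c < \<infinity>))) \<and>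
         (\<exists>A>0. \<exists>A'>0. \<forall>f :: real ^ 'n \<Rightarrow> 'b. f \<in> BMO_space \<omega> \<rho> \<longrightarrow>
            ennreal (BMO_norm \<omega> \<rho> f) \<le>
              ennreal A * (INF c\<in>admissible_families \<omega> \<rho> p f. max (osc_const \<omega> p f c) (log_const \<rho> c)) \<and>
            (INF c\<in>admissible_families \<omega> \<rho> p f. max (osc_const \<omega> p f c) (log_const \<rho> c)) \<le>
              ennreal A' * ennreal (BMO_norm \<omega> \<rho> f))"
proof -
  interpret root_configuration R b k
    using assms(1,3) unfolding normalized_root_system_def multiplicity_function_def
    by unfold_locales auto
  have "\<exists>\<kappa>. doubling_measure \<omega> \<kappa> (real CARD('n) + 2 * dunkl_gamma R b k)"
    using dunkl_measure_doubling unfolding assms(4) by simp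
  then obtain \<kappa> where "doubling_measure \<omega> \<kappa> (real CARD('n) + 2 * dunkl_gamma R b k)" by blast
  then interpret doubling_measure \<omega> \<kappa> "real CARD('n) + 2 * dunkl_gamma R b k" .
  have "\<not> (AE x in \<omega>. V x = 0)"
    using assms(6) unfolding assms(4) AE_dunkl_measure_iff[OF finite_P] .
  then have "0 < \<rho> x" for x
    using assms(5,7,8) unfolding assms(9) by (intro critical_radius_pos[where q=q]) auto
  then show ?thesis using assms(10) by (rule BMO_characterization)
qed

end
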